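(* Let $(X,\mathcal{A},\mu,T)$ be a measure preserving system with super-polynomial decay of correlations, and let $f:X\to\mathbb{R}^N$ be a Lipschitz observation such that the system is $\mu$-almost aperiodic for $f$. Assume Hypothesis (I) holds. Then for every $t\ge 0$ and for $\mu$-almost every $x_0\in X$ such that $\underline{d}_{f_*\mu}(f(x_0))>0$: \[\lim_{r\to0}\mu\left(x\in X:\ \tau_r^f(x,x_0)>\frac{t}{f_*\mu\left(B(f(x_0),r)\right)}\right)=e^{-t}\] and \[\lim_{r\to0}\mu_{f^{-1}B(f(x_0),r)}\left(x\in X:\ \tau_r^f(x,x_0)>\frac{t}{f_*\mu\left(B(f(x_0),r)\right)}\right)=e^{-t}.\]
   Context: A measure preserving system (m.p.s.) $(X,\mathcal{A},\mu,T)$: $X$ is a metric space, $\mathcal{A}$ its Borel $\sigma$-algebra, $\mu$ a Borel probability measure, $T:X\to X$ measurable with $\mu(T^{-1}A)=\mu(A)$ for all $A\in\mathcal{A}$. An observation is a measurable map $f:X\to\mathbb{R}^N$; $B(y,r)$ denotes the open ball of radius $r$ centered at $y$; $f_*\mu(\cdot)=\mu(f^{-1}(\cdot))$ is the pushforward measure; for a set $A$ of positive measure, $\mu_A(B)=\mu(A\cap B)/\mu(A)$ is the conditional measure. For $x,x_0\in X$ and $r>0$, the hitting time for the observation is $\tau_r^f(x,x_0)=\inf\{k\in\mathbb{N}^*: f(T^kx)\in B(f(x_0),r)\}$. The system is $\mu$-almost aperiodic for $f$ if $\mu(\{x\in X:\exists n\in\mathbb{N}^*,\ f(T^nx)=f(x)\})=0$.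 Lower pointwise dimension of a Borel probability measure $\nu$ at $y$: $\underline{d}_\nu(y)=\liminf_{r\to0}\frac{\log\nu(B(y,r))}{\log r}$. Super-polynomial decay of correlations: there is a sequence $(\theta_n)$ with $\lim_{n\to\infty}\theta_n n^p=0$ for every $p>0$ such that for every Lipschitz $\psi:X\to\mathbb{R}$, every bounded measurable $\phi:X\to\mathbb{R}$ and every $n\in\mathbb{N}^*$, $\left|\int\psi\cdot\phi\circ T^n\,d\mu-\int\psi\,d\mu\int\phi\,d\mu\right|\le\|\psi\|_{Lip}\|\phi\|_\infty\theta_n$, where $\|\psi\|_{Lip}$ is the Lipschitz constant of $\psi$. Hypothesis (I): for $f_*\mu$-almost every $y\in\mathbb{R}^N$ there exist $a>0$ and $b\ge0$ such that $f_*\mu\left(B(y,r)\setminus B(y,r-\rho)\right)\le r^{-b}\rho^a$ for every sufficiently small $r>0$ and every $0<\rho<r$. *)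

theory Defs
  imports "HOL-Analysis.Analysis" "HOL-Probability.Probability"
begin

definition lip_const :: "('a::metric_space \<Rightarrow> real) \<Rightarrow> real" where
  "lip_const \<psi> = (SUP p \<in> {(x, y). x \<noteq> y}. \<bar>\<psi> (fst p) - \<psi> (snd p)\<bar> / dist (fst p) (snd p))"

definition sup_norm :: "('a \<Rightarrow> real) \<Rightarrow> real" where
  "sup_norm \<phi> = (SUP x. \<bar>\<phi> x\<bar>)"

definition superpoly_decay :: "'a::metric_space measure \<Rightarrow> ('a \<Rightarrow> 'a) \<Rightarrow> bool" where
  "superpoly_decay M T \<longleftrightarrow>
     (\<exists>\<theta>::nat \<Rightarrow> real.
        (\<forall>p>0. ((\<lambda>n. \<theta> n * real n powr p) \<longlongrightarrow> 0) sequentially) \<and>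
        (\<forall>\<psi> \<phi> n. (\<exists>C. C-lipschitz_on UNIV \<psi>) \<longrightarrow> \<phi> \<in> borel_measurable M \<longrightarrow> bounded (range \<phi>)
            \<longrightarrow> n \<ge> 1 \<longrightarrow>
            \<bar>(\<integral>x. \<psi> x * \<phi> ((T ^^ n) x) \<partial>M) - (\<integral>x. \<psi> x \<partial>M) * (\<integral>x. \<phi> x \<partial>M)\<bar>
              \<le> lip_const \<psi> * sup_norm \<phi> * \<theta> n))"

definition hitting_time :: "('a \<Rightarrow> 'a) \<Rightarrow> ('a \<Rightarrow> 'b::metric_space) \<Rightarrow> real \<Rightarrow> 'a \<Rightarrow> 'a \<Rightarrow> ereal" where
  "hitting_time T f r x x0 =
     (if {k::nat. k \<ge> 1 \<and> f ((T ^^ k) x) \<in> ball (f x0) r} = {} then \<infinity>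
      else ereal (real (Inf {k::nat. k \<ge> 1 \<and> f ((T ^^ k) x) \<in> ball (f x0) r})))"

(* lower pointwise dimension; log 0 / log r is read as +infinity *)
definition lower_pointwise_dim :: "'b::metric_space measure \<Rightarrow> 'b \<Rightarrow> ereal" where
  "lower_pointwise_dim \<nu> y =
     Liminf (at_right (0::real))
       (\<lambda>r. if measure \<nu> (ball y r) = 0 then \<infinity>
            else ereal (ln (measure \<nu> (ball y r)) / ln r))"

definition hypothesis_I :: "'b::metric_space measure \<Rightarrow> bool" where
  "hypothesis_I \<nu> \<longleftrightarrow>
     (AE y in \<nu>. \<exists>a>0. \<exists>b\<ge>0. eventually (\<lambda>r. \<forall>\<rho>. 0 < \<rho> \<and> \<rho> < r \<longrightarrow>
        measure \<nu> (ball y r - ball y (r - \<rho>)) \<le> r powr (-b) * \<rho> powr a) (at_right 0))"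

end

theory Submission
  imports Defs
begin

text \<open>
  Write A for the preimage of the ball B(f(x0), r), m for its measure, and p(k), q(k) for the
  probability, respectively the probability conditional on A, of not visiting A at times 1, ..., k.
  Invariance gives p(k + 1) = p(k) - m q(k), so if q and p differ by at most \<delta> uniformly in k,
  then p(k) differs from (1 - m)^k by at most \<delta>, and (1 - m)^(t/m) tends to exp(-t). Forgetting the
  first n steps and applying decay of correlations to a Lipschitz approximation of the indicator
  function of A bounds \<delta> by the conditional probability of a return to A before time n, plus n m,
  plus a mixing error. For n of order r^(-d/2), where m is at most r^d, the mixing error is
  negligible thanks to hypothesis (I) and to the lower bound m \<ge> r^(N+2), valid for almost
  every x0.

  It remains to exclude returns before time n. The events that f(T^j x) is within 2 j^(-q) of f(x)
  at a point where the ball around f(x) has small mass are summable in j by decay of correlations,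
  and aperiodicity handles any finite set of times. So early returns into A occur only in sets P of
  arbitrarily small measure. A Besicovitch maximal inequality for the pushforward measure
  shows that, for almost every x0, the relative mass of some such P in A is small uniformly in r.
\<close>

section \<open>Separated sets and the Besicovitch covering argument\<close>

text \<open>The obstacle is that early returns must be negligible relative to A, whose mass tends to
  0, at a fixed centre x0; a bound on the measure of the set P of bad points does not give this by
  itself. The pushforward of \<open>M\<close> may fail to be doubling, so a Vitali covering gives no
  bound of the required kind, whereas the Besicovitch overlap constant depends on the dimension
  only. The exponents balance each other: n of order r^(-d/2) makes n m at most r^(d/2), while n is
  still a power of 1/r, so that super-polynomial decay beats both 1/m \<le> r^(-(N+2)) and the
  Lipschitz constant of an approximation whose layer has width r^c. The exponent d and the size of
  f(x0) vary with x0, but the bad sets must be built before x0 is chosen. Both are therefore encoded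
  in one natural number i, with d = 1/(i+1) and norm at most i, so that countably many null sets
  suffice.\<close>

definition grid_cell :: "real \<Rightarrow> real^'n \<Rightarrow> 'n \<Rightarrow> int" where
  "grid_cell \<rho> z = (\<lambda>i. \<lfloor>real CARD('n) * z $ i / \<rho>\<rfloor>)"

text \<open>Cells are cubes of side \<open>\<rho> / real CARD('n)\<close>; bounding the norm by the
  sum of the coordinates is what calls for the factor \<open>CARD('n)\<close> in
  \<open>grid_cell\<close>.\<close>

lemma dist_less_if_same_cell:
  fixes z z' :: "real^'n"
  assumes "\<rho> > 0" "grid_cell \<rho> z = grid_cell \<rho> z'"
  shows "dist z z' < \<rho>"
proof -
  let ?N = "real CARD('n)"
  have N: "?N > 0" by simp
  have *: "\<bar>(z - z') $ i\<bar> < \<rho> / ?N" for i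
  proof -
    have "\<lfloor>?N * z $ i / \<rho>\<rfloor> = \<lfloor>?N * z' $ i / \<rho>\<rfloor>"
      using assms(2) by (simp add: grid_cell_def fun_eq_iff)
    then have "\<bar>?N * z $ i / \<rho> - ?N * z' $ i / \<rho>\<bar> < 1"
      by linarith
    moreover have "?N * z $ i / \<rho> - ?N * z' $ i / \<rho> = (z - z') $ i * (?N / \<rho>)"
      by (simp add: algebra_simps diff_divide_distrib)
    ultimately have "\<bar>(z - z') $ i\<bar> * (?N / \<rho>) < 1"
      using assms(1) by (simp add: abs_mult)
    then show ?thesis using assms(1) N by (simp add: field_simps)
  qed
  have "dist z z' \<le> (\<Sum>i\<in>UNIV. \<bar>(z - z') $ i\<bar>)"
    by (metis dist_norm norm_le_l1_cart)
  also have "\<dots> < (\<Sum>i\<in>(UNIV::'n set). \<rho> / ?N)"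
    by (rule sum_strict_mono) (use * in auto)
  also have "\<dots> = \<rho>" by simp
  finally show ?thesis .
qed

text \<open>Cells are counted coordinatewise: over an interval of length \<open>s\<close>, the floor
  takes at most \<open>s + 2\<close> values.\<close>

lemma card_grid_cells_ball:
  fixes z :: "real^'n"
  assumes "\<rho> > 0" "t \<ge> 0"
  shows finite_grid_cells_ball: "finite (grid_cell \<rho> ` ball z t)"
    and "real (card (grid_cell \<rho> ` ball z t))
           \<le> (2 * real CARD('n) * t / \<rho> + 2) ^ CARD('n)"
proof -
  let ?N = "real CARD('n)"
  define I where "I i = {\<lfloor>?N * (z $ i - t) / \<rho>\<rfloor>..\<lfloor>?N * (z $ i + t) / \<rho>\<rfloor>}" for i
  have sub: "grid_cell \<rho> ` ball z t \<subseteq> PiE UNIV I"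
  proof clarify
    fix w assume w: "w \<in> ball z t"
    have "grid_cell \<rho> w i \<in> I i" for i
    proof -
      have "\<bar>(z - w) $ i\<bar> \<le> norm (z - w)" by (rule component_le_norm_cart)
      also have "\<dots> \<le> t" using w by (simp add: dist_norm)
      finally have "z $ i - t \<le> w $ i" "w $ i \<le> z $ i + t" by auto
      then show ?thesis
        unfolding I_def grid_cell_def using assms
        by (auto intro!: floor_mono divide_right_mono mult_left_mono)
    qed
    then show "grid_cell \<rho> w \<in> PiE UNIV I" by auto
  qed
  have fin: "finite (PiE UNIV I)" by (rule finite_PiE) (auto simp: I_def)
  show "finite (grid_cell \<rho> ` ball z t)" using sub fin by (rule finite_subset)
  have "card (grid_cell \<rho> ` ball z t) \<le> (\<Prod>i\<in>UNIV. card (I i))"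
    using card_mono[OF fin sub] by (simp add: card_PiE)
  then have "real (card (grid_cell \<rho> ` ball z t)) \<le> (\<Prod>i\<in>UNIV. real (card (I i)))"
    by (metis of_nat_mono of_nat_prod)
  also have "\<dots> \<le> (\<Prod>i\<in>(UNIV::'n set). 2 * ?N * t / \<rho> + 2)"
  proof (rule prod_mono, safe)
    fix i
    have "?N * (z $ i + t) / \<rho> = ?N * (z $ i - t) / \<rho> + 2 * ?N * t / \<rho>"
      by (simp add: field_simps add_divide_distrib diff_divide_distrib)
    moreover have "2 * ?N * t / \<rho> \<ge> 0" using assms by simp
    ultimately show "real (card (I i)) \<le> 2 * ?N * t / \<rho> + 2"
      unfolding I_def by (simp add: of_nat_nat) linarith
  qed auto
  also have "\<dots> = (2 * ?N * t / \<rho> + 2) ^ CARD('n)" by simp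
  finally show "real (card (grid_cell \<rho> ` ball z t)) \<le> (2 * ?N * t / \<rho> + 2) ^ CARD('n)" .
qed

lemma card_separated_le_card_cells:
  fixes A :: "(real^'n) set"
  assumes "\<rho> > 0" "t \<ge> 0" "A \<subseteq> ball z t"
    and sep: "\<And>x x'. \<lbrakk>x \<in> A; x' \<in> A; x \<noteq> x'\<rbrakk> \<Longrightarrow> dist x x' \<ge> \<rho>"
  shows "card A \<le> card (grid_cell \<rho> ` ball z t)"
proof (rule card_inj_on_le)
  show "inj_on (grid_cell \<rho>) A"
    by (rule inj_onI, rule ccontr) (meson assms(1) dist_less_if_same_cell not_less sep)
  show "grid_cell \<rho> ` A \<subseteq> grid_cell \<rho> ` ball z t" using assms(3) by auto
qed (use assms finite_grid_cells_ball in blast)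

lemma card_separated_le:
  fixes A :: "(real^'n) set"
  assumes "\<rho> > 0" "t \<ge> 0" "A \<subseteq> ball z t"
    and "\<And>x x'. \<lbrakk>x \<in> A; x' \<in> A; x \<noteq> x'\<rbrakk> \<Longrightarrow> dist x x' \<ge> \<rho>"
  shows "real (card A) \<le> (2 * real CARD('n) * t / \<rho> + 2) ^ CARD('n)"
  using card_separated_le_card_cells[OF assms] card_grid_cells_ball(2)[OF assms(1,2), of z] by linarith

text \<open>A separated set of greatest cardinality exists because the cells of a bounded region
  bound all cardinalities; a point left uncovered could be adjoined to it.\<close>

lemma maximal_separated_subset:
  fixes S :: "(real^'n) set"
  assumes "bounded S" "\<rho> > 0"
  obtains A where "finite A" "A \<subseteq> S" "\<And>x x'. \<lbrakk>x \<in> A; x' \<in> A; x \<noteq> x'\<rbrakk> \<Longrightarrow> dist x x' \<ge> \<rho>"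
    "S \<subseteq> (\<Union>x\<in>A. ball x \<rho>)"
proof -
  obtain t where t: "t > 0" "S \<subseteq> ball 0 t"
    using assms(1) bounded_subset_ballD[of S 0] by auto
  define P where "P A \<longleftrightarrow> A \<subseteq> S \<and> finite A \<and> (\<forall>x\<in>A. \<forall>x'\<in>A. x \<noteq> x' \<longrightarrow> dist x x' \<ge> \<rho>)" for A
  have bound: "card A \<le> card (grid_cell \<rho> ` ball (0::real^'n) t)" if "P A" for A
    using that t assms(2) unfolding P_def by (intro card_separated_le_card_cells) auto
  have "P {}" by (simp add: P_def)
  then have "\<exists>A. P A \<and> (\<forall>A'. P A' \<longrightarrow> card A' \<le> card A)"
    by (rule ex_has_greatest_nat[of P _ card "Suc (card (grid_cell \<rho> ` ball (0::real^'n) t))"])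
      (use bound le_imp_less_Suc in blast)
  then obtain A where A: "P A" "\<And>A'. P A' \<Longrightarrow> card A' \<le> card A" by blast
  have "S \<subseteq> (\<Union>x\<in>A. ball x \<rho>)"
  proof (rule ccontr)
    assume "\<not> ?thesis"
    then obtain z where z: "z \<in> S" "\<And>x. x \<in> A \<Longrightarrow> dist x z \<ge> \<rho>" by force
    then have "z \<notin> A" using assms(2) by force
    have "P (insert z A)" using A(1) z by (auto simp: P_def dist_commute)
    then have "card (insert z A) \<le> card A" by (rule A(2))
    then show False using \<open>z \<notin> A\<close> A(1) by (simp add: P_def)
  qed
  then show ?thesis using A(1) that[of A] by (auto simp: P_def)
qed

text \<open>Greedy choice by decreasing radius, which is why the radii must be finite in number.
  Among the centres of largest radius \<open>R\<close> a maximal \<open>R\<close>-separated set is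
  taken, and centres already covered are dropped. A later centre lies outside every earlier ball,
  whose radius is at least as large, so the distance dominates both radii.\<close>

lemma besicovitch_selection:
  fixes S :: "(real^'n) set"
  assumes "finite (rad ` S)" "bounded S" "\<And>x. x \<in> S \<Longrightarrow> rad x > 0"
  shows "\<exists>A. finite A \<and> A \<subseteq> S \<and> (\<forall>x\<in>A. \<forall>x'\<in>A. x \<noteq> x' \<longrightarrow> dist x x' \<ge> max (rad x) (rad x')) \<and>
    S \<subseteq> (\<Union>x\<in>A. ball x (rad x))"
  using assms
proof (induction "card (rad ` S)" arbitrary: S rule: less_induct)
  case less
  show ?case
  proof (cases "S = {}")
    case True
    then show ?thesis by (intro exI[of _ "{}"]) auto
  next
    case False
    define R where "R = Max (rad ` S)"
    have R: "R \<in> rad ` S" unfolding R_def using less.prems False by (intro Max_in) auto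
    have Rge: "rad x \<le> R" if "x \<in> S" for x unfolding R_def using less.prems that by auto
    have "R > 0" using R less.prems by auto
    define S1 where "S1 = {x \<in> S. rad x = R}"
    have "bounded S1" using less.prems(2) by (rule bounded_subset) (auto simp: S1_def)
    then obtain A1 where A1: "finite A1" "A1 \<subseteq> S1" "\<And>x x'. \<lbrakk>x \<in> A1; x' \<in> A1; x \<noteq> x'\<rbrakk> \<Longrightarrow> dist x x' \<ge> R"
      "S1 \<subseteq> (\<Union>x\<in>A1. ball x R)"
      using maximal_separated_subset \<open>R > 0\<close> by metis
    define S2 where "S2 = S - S1 - (\<Union>x\<in>A1. ball x R)"
    have sub: "S2 \<subseteq> S" by (auto simp: S2_def)
    have "R \<notin> rad ` S2" by (auto simp: S2_def S1_def)
    then have "rad ` S2 \<subset> rad ` S" using sub R by blast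
    then have "card (rad ` S2) < card (rad ` S)" using less.prems(1) by (rule psubset_card_mono[rotated])
    moreover have "finite (rad ` S2)" using less.prems(1) sub by (meson finite_subset image_mono)
    moreover have "bounded S2" using less.prems(2) sub by (rule bounded_subset)
    ultimately obtain A2 where A2: "finite A2" "A2 \<subseteq> S2"
      "\<forall>x\<in>A2. \<forall>x'\<in>A2. x \<noteq> x' \<longrightarrow> dist x x' \<ge> max (rad x) (rad x')"
      "S2 \<subseteq> (\<Union>x\<in>A2. ball x (rad x))"
      using less.hyps[of S2] less.prems(3) sub by (metis subsetD)
    have mixed: "dist x x' \<ge> max (rad x) (rad x')" if "x \<in> A1" "x' \<in> A2" for x x'
    proof -
      have "x' \<notin> ball x R" using that A2(2) by (auto simp: S2_def)
      then have "dist x x' \<ge> R" by simp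
      then show ?thesis using Rge that A1(2) A2(2) sub by (force simp: S1_def)
    qed
    show ?thesis
    proof (intro exI[of _ "A1 \<union> A2"] conjI)
      show "finite (A1 \<union> A2)" using A1 A2 by auto
      show "A1 \<union> A2 \<subseteq> S" using A1(2) A2(2) sub by (auto simp: S1_def)
      have "rad x = R" if "x \<in> A1" for x using that A1(2) by (auto simp: S1_def)
      then show "\<forall>x\<in>A1 \<union> A2. \<forall>x'\<in>A1 \<union> A2. x \<noteq> x' \<longrightarrow> dist x x' \<ge> max (rad x) (rad x')"
        using A1(3) A2(3) mixed by (metis UnE dist_commute max.commute max.idem)
      show "S \<subseteq> (\<Union>x\<in>A1 \<union> A2. ball x (rad x))"
        using A1(2,4) A2(4) by (fastforce simp: S2_def S1_def)
    qed
  qed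
qed

text \<open>Unit vectors at distance less than 1 enclose an angle below 60 degrees, so the third side of
  the triangle is not the strictly longest one.\<close>

lemma norm_diff_le_max_if_near_directions:
  fixes u v :: "'a::real_inner"
  assumes "dist (sgn u) (sgn v) < 1"
  shows "norm (u - v) \<le> max (norm u) (norm v)"
proof (cases "u = 0 \<or> v = 0")
  case True
  then show ?thesis by auto
next
  case False
  let ?a = "norm u" and ?b = "norm v"
  have pos: "?a > 0" "?b > 0" using False by auto
  have "(dist (sgn u) (sgn v))\<^sup>2 < 1"
    using assms by (simp add: power_less_one_iff)
  then have "2 - 2 * (sgn u \<bullet> sgn v) < 1"
    using False by (simp add: dist_norm power2_norm_eq_inner inner_diff_left inner_diff_right inner_commute
        flip: norm_sgn) (simp add: norm_sgn norm_eq_sqrt_inner[symmetric] flip: power2_norm_eq_inner)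
  then have "sgn u \<bullet> sgn v \<ge> 1/2" by simp
  moreover have "u \<bullet> v = ?a * ?b * (sgn u \<bullet> sgn v)"
    using pos by (simp add: sgn_div_norm field_simps)
  ultimately have "u \<bullet> v \<ge> ?a * ?b * (1/2)" using pos by (metis mult_left_mono mult_pos_pos less_imp_le)
  then have "(norm (u - v))\<^sup>2 \<le> ?a\<^sup>2 + ?b\<^sup>2 - ?a * ?b"
    by (simp add: power2_norm_eq_inner inner_diff_left inner_diff_right inner_commute)
  also have "\<dots> \<le> (max ?a ?b)\<^sup>2"
    by (cases "?a \<le> ?b") (use pos in \<open>auto simp: max_def power2_eq_square mult_mono\<close>)
  finally show ?thesis by (rule power2_le_imp_le) (simp add: le_max_iff_disj)
qed

text \<open>The directions from \<open>z\<close> to two centres cannot share a cell of size 1: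
  otherwise the centres would be no farther apart than the larger of their distances to
  \<open>z\<close>, which is less than the larger radius. The open ball of radius 2 contains all
  unit vectors and 0.\<close>

lemma besicovitch_overlap:
  fixes A :: "(real^'n) set"
  assumes "finite A" "\<And>x x'. \<lbrakk>x \<in> A; x' \<in> A; x \<noteq> x'\<rbrakk> \<Longrightarrow> dist x x' \<ge> max (rad x) (rad x')"
  shows "card {x \<in> A. z \<in> ball x (rad x)} \<le> card (grid_cell 1 ` ball (0::real^'n) 2)"
proof (rule card_inj_on_le[where f = "\<lambda>x. grid_cell 1 (sgn (x - z))"])
  show "inj_on (\<lambda>x. grid_cell 1 (sgn (x - z))) {x \<in> A. z \<in> ball x (rad x)}"
  proof (rule inj_onI, rule ccontr)
    fix x x'
    assume x: "x \<in> {x \<in> A. z \<in> ball x (rad x)}" "x' \<in> {x \<in> A. z \<in> ball x (rad x)}"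
      and eq: "grid_cell 1 (sgn (x - z)) = grid_cell 1 (sgn (x' - z))" and ne: "x \<noteq> x'"
    have "norm ((x - z) - (x' - z)) \<le> max (norm (x - z)) (norm (x' - z))"
      by (rule norm_diff_le_max_if_near_directions) (rule dist_less_if_same_cell[OF _ eq], simp)
    also have "\<dots> < max (rad x) (rad x')"
      using x by (auto simp: dist_norm)
    finally show False using assms(2)[of x x'] x ne by (auto simp: dist_norm max_def split: if_splits)
  qed
  show "(\<lambda>x. grid_cell 1 (sgn (x - z))) ` {x \<in> A. z \<in> ball x (rad x)} \<subseteq> grid_cell 1 ` ball 0 2"
    by (auto simp: norm_sgn intro!: imageI)
qed (simp add: finite_grid_cells_ball)

section \<open>A maximal inequality\<close>

context prob_space
begin

lemma sets_Int_vimage_ball: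
  fixes f :: "'a \<Rightarrow> 'b::metric_space"
  assumes "f \<in> borel_measurable M" "P \<in> sets M"
  shows "P \<inter> f -` ball y r \<in> sets M"
proof -
  have "P \<inter> f -` ball y r = P \<inter> (f -` ball y r \<inter> space M)"
    using sets.sets_into_space[OF assms(2)] by auto
  then show ?thesis using assms measurable_sets[OF assms(1), of "ball y r"] by auto
qed

text \<open>The preimages of the balls centred at \<open>y\<close> are the sections of one
  measurable subset of the product, and measures of sections depend measurably on
  \<open>y\<close>.\<close>

lemma borel_measurable_prob_ball:
  fixes f :: "'a \<Rightarrow> real^'n"
  assumes [measurable]: "f \<in> borel_measurable M" "P \<in> sets M"
  shows "(\<lambda>y. prob (P \<inter> f -` ball y r)) \<in> borel_measurable borel"
proof -
  have "{p \<in> space (borel \<Otimes>\<^sub>M M). dist (fst p) (f (snd p)) < r \<and> snd p \<in> P} \<in> sets (borel \<Otimes>\<^sub>M M)"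
    by measurable
  then have "(\<lambda>y. emeasure M (Pair y -` {p \<in> space (borel \<Otimes>\<^sub>M M). dist (fst p) (f (snd p)) < r \<and> snd p \<in> P}))
      \<in> borel_measurable borel"
    by (rule measurable_emeasure_Pair)
  moreover have "Pair y -` {p \<in> space (borel \<Otimes>\<^sub>M M). dist (fst p) (f (snd p)) < r \<and> snd p \<in> P}
      = P \<inter> f -` ball y r" for y
    using sets.sets_into_space[OF assms(2)] by (auto simp: space_pair_measure)
  ultimately show ?thesis unfolding measure_def by simp
qed

text \<open>Integrate the number of sets \<open>B i\<close> containing a point: it is at most
  \<open>c\<close> on \<open>P\<close> and 0 elsewhere.\<close>

lemma sum_prob_le_overlap:
  assumes "finite K" and [measurable]: "\<And>i. i \<in> K \<Longrightarrow> B i \<in> sets M" "P \<in> sets M"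
    and sub: "\<And>i. i \<in> K \<Longrightarrow> B i \<subseteq> P"
    and overlap: "\<And>w. real (card {i \<in> K. w \<in> B i}) \<le> c"
  shows "(\<Sum>i\<in>K. prob (B i)) \<le> c * prob P"
proof -
  have "(\<Sum>i\<in>K. prob (B i)) = (\<Sum>i\<in>K. \<integral>w. indicator (B i) w \<partial>M)" by simp
  also have "\<dots> = (\<integral>w. (\<Sum>i\<in>K. indicator (B i) w) \<partial>M)"
    by (rule Bochner_Integration.integral_sum[symmetric]) (auto simp: emeasure_eq_measure)
  also have "\<dots> \<le> (\<integral>w. c * indicator P w \<partial>M)"
  proof (rule integral_mono)
    fix w
    have eq: "(\<Sum>i\<in>K. indicator (B i) w :: real) = real (card {i \<in> K. w \<in> B i})"
      using assms(1) by (simp add: indicator_def of_bool_def sum.If_cases Int_def)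
    show "(\<Sum>i\<in>K. indicator (B i) w) \<le> c * indicator P w"
    proof (cases "w \<in> P")
      case False
      then have "(\<Sum>i\<in>K. indicator (B i) w :: real) = 0" using sub by (intro sum.neutral) (auto simp: indicator_def)
      then show ?thesis using False by simp
    qed (use eq overlap[of w] in simp)
  qed (auto intro!: Bochner_Integration.integrable_sum simp: emeasure_eq_measure)
  also have "\<dots> = c * prob P" by simp
  finally show ?thesis .
qed

text \<open>Weak-type estimate: each \<open>y\<close> in \<open>S\<close> owns a ball in which
  \<open>P\<close> has relative mass above \<open>s\<close>. The selected balls cover
  \<open>S\<close>, and their traces on \<open>P\<close> overlap at most a fixed number of
  times.\<close>

lemma maximal_inequality_finitely_many_radii:
  fixes f :: "'a \<Rightarrow> real^'n" and R :: real
  assumes [measurable]: "f \<in> borel_measurable M" "P \<in> sets M"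
    and s: "s > 0" and F: "finite F" "\<And>r. r \<in> F \<Longrightarrow> r > 0"
  defines "S \<equiv> {y \<in> ball 0 R. \<exists>r\<in>F. prob (P \<inter> f -` ball y r) > s * prob (space M \<inter> f -` ball y r)}"
  shows "s * prob (space M \<inter> f -` S) \<le> real (card (grid_cell 1 ` ball (0::real^'n) 2)) * prob P"
proof -
  let ?K = "card (grid_cell 1 ` ball (0::real^'n) 2)"
  define rad where "rad y = (SOME r. r \<in> F \<and> prob (P \<inter> f -` ball y r) > s * prob (space M \<inter> f -` ball y r))" for y
  have rad: "rad y \<in> F" "prob (P \<inter> f -` ball y (rad y)) > s * prob (space M \<inter> f -` ball y (rad y))"
    if "y \<in> S" for y
    using that someI_ex[of "\<lambda>r. r \<in> F \<and> prob (P \<inter> f -` ball y r) > s * prob (space M \<inter> f -` ball y r)"]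
    by (auto simp: S_def rad_def)
  have "finite (rad ` S)" using F(1) by (rule finite_subset[rotated]) (use rad in auto)
  moreover have "bounded S" by (rule bounded_subset[OF bounded_ball[of 0 R]]) (auto simp: S_def)
  moreover have "rad x > 0" if "x \<in> S" for x using rad(1)[OF that] by (rule F(2))
  ultimately have "\<exists>A. finite A \<and> A \<subseteq> S \<and>
      (\<forall>x\<in>A. \<forall>x'\<in>A. x \<noteq> x' \<longrightarrow> dist x x' \<ge> max (rad x) (rad x')) \<and> S \<subseteq> (\<Union>x\<in>A. ball x (rad x))"
    by (rule besicovitch_selection)
  then obtain A where A: "finite A" "A \<subseteq> S"
    "\<And>x x'. \<lbrakk>x \<in> A; x' \<in> A; x \<noteq> x'\<rbrakk> \<Longrightarrow> dist x x' \<ge> max (rad x) (rad x')"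
    "S \<subseteq> (\<Union>x\<in>A. ball x (rad x))"
    by auto
  note [measurable] = sets_Int_vimage_ball[OF assms(1)]
  have "prob (space M \<inter> f -` S) \<le> prob (\<Union>x\<in>A. space M \<inter> f -` ball x (rad x))"
  proof (rule finite_measure_mono)
    show "space M \<inter> f -` S \<subseteq> (\<Union>x\<in>A. space M \<inter> f -` ball x (rad x))" using A(4) by blast
    show "(\<Union>x\<in>A. space M \<inter> f -` ball x (rad x)) \<in> events"
      using A(1) by (rule sets.finite_UN) measurable
  qed
  also have "\<dots> \<le> (\<Sum>x\<in>A. prob (space M \<inter> f -` ball x (rad x)))"
    using A(1) by (intro finite_measure_subadditive_finite) auto
  finally have "s * prob (space M \<inter> f -` S) \<le> (\<Sum>x\<in>A. s * prob (space M \<inter> f -` ball x (rad x)))"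
    using s by (simp add: sum_distrib_left[symmetric])
  also have "\<dots> \<le> (\<Sum>x\<in>A. prob (P \<inter> f -` ball x (rad x)))"
    using rad(2) A(2) by (intro sum_mono) (auto intro: less_imp_le)
  also have "\<dots> \<le> real ?K * prob P"
  proof (rule sum_prob_le_overlap[OF A(1)])
    fix w
    have "card {x \<in> A. w \<in> P \<inter> f -` ball x (rad x)} \<le> card {x \<in> A. f w \<in> ball x (rad x)}"
      using A(1) by (intro card_mono) auto
    also have "\<dots> \<le> ?K" by (rule besicovitch_overlap[OF A(1,3)])
    finally show "real (card {x \<in> A. w \<in> P \<inter> f -` ball x (rad x)}) \<le> real ?K" by simp
  qed auto
  finally show ?thesis .
qed

text \<open>An open ball is the increasing union of smaller ones, so a strict lower bound on its
  mass survives a small decrease of the radius. This reduces all radii to rational ones.\<close>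

lemma prob_ball_left_continuous:
  fixes f :: "'a \<Rightarrow> real^'n"
  assumes [measurable]: "f \<in> borel_measurable M" "P \<in> sets M"
    and "c < prob (P \<inter> f -` ball y r)" "r > 0"
  obtains q where "q \<in> \<rat>" "0 < q" "q < r" "c < prob (P \<inter> f -` ball y q)"
proof -
  \<comment> \<open>The shift by 2 keeps \<open>\<rho> n\<close> positive already for
    \<open>n = 0\<close>.\<close>
  define \<rho> where "\<rho> n = r - r / real (n + 2)" for n
  note sets = sets_Int_vimage_ball[OF assms(1,2)]
  have lim: "\<rho> \<longlonglongrightarrow> r - 0"
    unfolding \<rho>_def
    by (intro tendsto_diff tendsto_const LIMSEQ_ignore_initial_segment[OF lim_const_over_n])
  have \<rho>_pos: "\<rho> n > 0" and \<rho>_less: "\<rho> n < r" for n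
    using \<open>r > 0\<close> by (auto simp: \<rho>_def field_simps add_pos_nonneg)
  have mono: "incseq (\<lambda>n. P \<inter> f -` ball y (\<rho> n))"
  proof (rule incseq_SucI)
    fix n
    have "\<rho> n \<le> \<rho> (Suc n)"
      using \<open>r > 0\<close> by (simp add: \<rho>_def frac_le)
    then show "P \<inter> f -` ball y (\<rho> n) \<subseteq> P \<inter> f -` ball y (\<rho> (Suc n))" by auto
  qed
  have un: "(\<Union>n. P \<inter> f -` ball y (\<rho> n)) = P \<inter> f -` ball y r"
  proof (intro equalityI subsetI)
    fix w assume w: "w \<in> P \<inter> f -` ball y r"
    then have "eventually (\<lambda>n. dist y (f w) < \<rho> n) sequentially"
      using lim by (intro order_tendstoD(1)[of \<rho> r]) auto
    then obtain n where "dist y (f w) < \<rho> n" by (auto simp: eventually_sequentially)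
    then show "w \<in> (\<Union>n. P \<inter> f -` ball y (\<rho> n))" using w by auto
  qed (use \<rho>_less less_trans in fastforce)
  have "(\<lambda>n. prob (P \<inter> f -` ball y (\<rho> n))) \<longlonglongrightarrow> prob (P \<inter> f -` ball y r)"
    using finite_Lim_measure_incseq[OF _ mono] sets un by auto
  then have "eventually (\<lambda>n. c < prob (P \<inter> f -` ball y (\<rho> n))) sequentially"
    using assms(3) by (rule order_tendstoD)
  then obtain n where n: "c < prob (P \<inter> f -` ball y (\<rho> n))" by (auto simp: eventually_sequentially)
  obtain q where q: "q \<in> \<rat>" "\<rho> n < q" "q < r" using Rats_dense_in_real[OF \<rho>_less] by blast
  have "prob (P \<inter> f -` ball y (\<rho> n)) \<le> prob (P \<inter> f -` ball y q)"
    using q sets by (intro finite_measure_mono) auto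
  then show ?thesis using that[of q] q n \<rho>_pos[of n] by auto
qed

text \<open>The sets \<open>Sn n\<close> exhaust the maximal set by finitely many rational radii in
  bounded regions. The bound depends on neither the radii nor the region, so it passes to the
  limit.\<close>

lemma maximal_inequality:
  fixes f :: "'a \<Rightarrow> real^'n"
  assumes [measurable]: "f \<in> borel_measurable M" "P \<in> sets M" and s: "s > 0"
  defines "W \<equiv> {x \<in> space M. \<exists>r>0. prob (P \<inter> f -` ball (f x) r) > s * prob (space M \<inter> f -` ball (f x) r)}"
  shows sets_maximal_set: "W \<in> sets M"
    and "s * prob W \<le> real (card (grid_cell 1 ` ball (0::real^'n) 2)) * prob P"
proof -
  define Q where "Q = {r \<in> \<rat>. r > (0::real)}"
  define e where "e = from_nat_into Q"
  have "Q \<noteq> {}" unfolding Q_def by (auto intro!: exI[of _ 1])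
  moreover have "countable Q" unfolding Q_def using countable_rat by (rule countable_subset[rotated]) auto
  ultimately have e: "range e = Q" unfolding e_def by (rule range_from_nat_into)
  then have e_pos: "e n > 0" for n by (metis (mono_tags, lifting) Q_def mem_Collect_eq rangeI)
  define Sn where "Sn n = {y \<in> ball 0 (real n). \<exists>r\<in>e ` {..n}. prob (P \<inter> f -` ball y r) > s * prob (space M \<inter> f -` ball y r)}" for n
  have [measurable]: "Sn n \<in> sets borel" for n
  proof -
    note [measurable] = borel_measurable_prob_ball[OF assms(1)]
    show ?thesis unfolding Sn_def by measurable
  qed
  have W: "W = (\<Union>n. space M \<inter> f -` Sn n)"
  proof (intro equalityI subsetI)
    fix x assume "x \<in> W"
    then obtain r where r: "x \<in> space M" "r > 0"
      "prob (P \<inter> f -` ball (f x) r) > s * prob (space M \<inter> f -` ball (f x) r)"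
      by (auto simp: W_def)
    then obtain q where q: "q \<in> \<rat>" "0 < q" "q < r"
      "s * prob (space M \<inter> f -` ball (f x) r) < prob (P \<inter> f -` ball (f x) q)"
      using prob_ball_left_continuous[OF assms(1,2)] by blast
    have "prob (space M \<inter> f -` ball (f x) q) \<le> prob (space M \<inter> f -` ball (f x) r)"
      using q(3) measurable_sets[OF assms(1), of "ball (f x) r"]
      by (intro finite_measure_mono) (auto simp: Int_commute)
    then have q': "prob (P \<inter> f -` ball (f x) q) > s * prob (space M \<inter> f -` ball (f x) q)"
      using q(4) s by (meson le_less_trans mult_left_mono less_imp_le)
    have "q \<in> range e" using q e by (auto simp: Q_def)
    then obtain k where k: "q = e k" by auto
    obtain k' where k': "norm (f x) < real k'" using reals_Archimedean2 by blast
    have "f x \<in> Sn (max k k')"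
      unfolding Sn_def using k k' q' by (auto intro!: bexI[of _ k])
    then show "x \<in> (\<Union>n. space M \<inter> f -` Sn n)" using r by auto
  next
    fix x assume "x \<in> (\<Union>n. space M \<inter> f -` Sn n)"
    then show "x \<in> W" using e_pos by (auto simp: W_def Sn_def)
  qed
  have sets: "space M \<inter> f -` Sn n \<in> sets M" for n
    using measurable_sets[OF assms(1), of "Sn n"] by (simp add: Int_commute)
  show "W \<in> sets M" unfolding W using sets by auto
  have inc: "incseq (\<lambda>n. space M \<inter> f -` Sn n)"
  proof (rule incseq_SucI)
    fix n
    have "e ` {..n} \<subseteq> e ` {..Suc n}" by auto
    moreover have "ball 0 (real n) \<subseteq> ball (0::real^'n) (real (Suc n))" by auto
    ultimately show "space M \<inter> f -` Sn n \<subseteq> space M \<inter> f -` Sn (Suc n)" unfolding Sn_def by blast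
  qed
  have "(\<lambda>n. s * prob (space M \<inter> f -` Sn n)) \<longlonglongrightarrow> s * prob W"
    unfolding W using sets inc by (intro tendsto_intros finite_Lim_measure_incseq) auto
  then show "s * prob W \<le> real (card (grid_cell 1 ` ball (0::real^'n) 2)) * prob P"
  proof (rule LIMSEQ_le_const2, intro exI allI impI)
    fix n
    show "s * prob (space M \<inter> f -` Sn n) \<le> real (card (grid_cell 1 ` ball (0::real^'n) 2)) * prob P"
      unfolding Sn_def using e_pos by (intro maximal_inequality_finitely_many_radii assms) auto
  qed
qed

text \<open>This replaces the Lebesgue density theorem, which does not apply as the sets P need not be
  unions of fibres of f.\<close>

lemma AE_relative_mass_vanishes:
  fixes f :: "'a \<Rightarrow> real^'n"
  assumes [measurable]: "f \<in> borel_measurable M" "\<And>J::nat. P J \<in> sets M"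
    and lim: "(\<lambda>J. prob (P J)) \<longlonglongrightarrow> 0"
  shows "AE x in M. \<forall>s>0. \<exists>J. \<forall>r>0. prob (P J \<inter> f -` ball (f x) r) \<le> s * prob (space M \<inter> f -` ball (f x) r)"
proof -
  let ?K = "real (card (grid_cell 1 ` ball (0::real^'n) 2))"
  define W where "W s J = {x \<in> space M. \<exists>r>0. prob (P J \<inter> f -` ball (f x) r) > s * prob (space M \<inter> f -` ball (f x) r)}" for s J
  have sets: "W s J \<in> sets M" if "s > 0" for s J
    unfolding W_def using that by (intro sets_maximal_set) auto
  have null: "(\<Inter>J. W s J) \<in> null_sets M" if s: "s > 0" for s
  proof -
    have W: "(\<Inter>J. W s J) \<in> sets M" using sets[OF s] by auto
    have "prob (\<Inter>J. W s J) \<le> ?K * prob (P J) / s" for J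
    proof -
      have "s * prob (W s J) \<le> ?K * prob (P J)"
        unfolding W_def using s by (intro maximal_inequality) auto
      moreover have "prob (\<Inter>J. W s J) \<le> prob (W s J)"
        using sets[OF s] by (intro finite_measure_mono) auto
      ultimately show ?thesis using s by (simp add: field_simps) (meson order_trans mult_left_mono less_imp_le)
    qed
    moreover have "(\<lambda>J. ?K * prob (P J) / s) \<longlonglongrightarrow> ?K * 0 / s"
      using s by (intro tendsto_intros lim) auto
    ultimately have "prob (\<Inter>J. W s J) \<le> ?K * 0 / s"
      by (intro LIMSEQ_le_const) auto
    then show ?thesis using W by (auto simp: null_sets_def emeasure_eq_measure intro: antisym)
  qed
  have "AE x in M. \<forall>n::nat. x \<notin> (\<Inter>J. W (1 / real (Suc n)) J)"
    unfolding AE_all_countable by (intro allI AE_not_in null) simp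
  then show ?thesis
  proof (rule AE_mp, intro AE_I2 impI allI)
    fix x s assume x: "x \<in> space M" "\<forall>n::nat. x \<notin> (\<Inter>J. W (1 / real (Suc n)) J)" and s: "(s::real) > 0"
    obtain n where n: "1 / real (Suc n) < s" using s nat_approx_posE by blast
    obtain J where J: "x \<notin> W (1 / real (Suc n)) J" using x(2) by blast
    have "prob (P J \<inter> f -` ball (f x) r) \<le> s * prob (space M \<inter> f -` ball (f x) r)" if "r > 0" for r
    proof -
      have "prob (P J \<inter> f -` ball (f x) r) \<le> 1 / real (Suc n) * prob (space M \<inter> f -` ball (f x) r)"
        using J x(1) that unfolding W_def by (force simp: not_less)
      also have "\<dots> \<le> s * prob (space M \<inter> f -` ball (f x) r)"
        using n by (intro mult_right_mono) auto
      finally show ?thesis .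
    qed
    then show "\<exists>J. \<forall>r>0. prob (P J \<inter> f -` ball (f x) r) \<le> s * prob (space M \<inter> f -` ball (f x) r)" by blast
  qed
qed

text \<open>The centres lie in the image of \<open>G\<close>, so whatever the definition of
  \<open>G\<close> requires of \<open>f x\<close> holds at every centre.\<close>

lemma prob_le_sum_balls:
  fixes f :: "'a \<Rightarrow> real^'n"
  assumes f: "f \<in> borel_measurable M" and G: "G \<in> sets M" "f ` G \<subseteq> ball 0 R" and "R \<ge> 0" "\<rho> > 0"
  obtains Y where "finite Y" "Y \<subseteq> f ` G" "\<And>x x'. \<lbrakk>x \<in> Y; x' \<in> Y; x \<noteq> x'\<rbrakk> \<Longrightarrow> dist x x' \<ge> \<rho>"
    "real (card Y) \<le> (2 * real CARD('n) * R / \<rho> + 2) ^ CARD('n)"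
    "prob G \<le> (\<Sum>y\<in>Y. prob (G \<inter> f -` ball y \<rho>))"
proof -
  have "bounded (f ` G)" using G(2) by (rule bounded_subset[rotated]) simp
  then obtain Y where Y: "finite Y" "Y \<subseteq> f ` G" "\<And>x x'. \<lbrakk>x \<in> Y; x' \<in> Y; x \<noteq> x'\<rbrakk> \<Longrightarrow> dist x x' \<ge> \<rho>"
    "f ` G \<subseteq> (\<Union>x\<in>Y. ball x \<rho>)"
    using maximal_separated_subset[OF _ \<open>\<rho> > 0\<close>] by metis
  note sets = sets_Int_vimage_ball[OF f G(1)]
  have "G \<subseteq> (\<Union>y\<in>Y. G \<inter> f -` ball y \<rho>)" using Y(4) by blast
  then have "prob G \<le> prob (\<Union>y\<in>Y. G \<inter> f -` ball y \<rho>)"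
    using sets Y(1) by (intro finite_measure_mono sets.finite_UN) auto
  also have "\<dots> \<le> (\<Sum>y\<in>Y. prob (G \<inter> f -` ball y \<rho>))"
    using sets Y(1) by (intro finite_measure_subadditive_finite) auto
  finally have "prob G \<le> (\<Sum>y\<in>Y. prob (G \<inter> f -` ball y \<rho>))" .
  moreover have "Y \<subseteq> ball 0 R" using Y(2) G(2) by blast
  ultimately show ?thesis
    using that[of Y] Y card_separated_le[of \<rho> R Y 0] assms(4,5) by blast
qed

end

section \<open>Hitting and return statistics\<close>

text \<open>With \<open>k\<close> for the floor, the logarithm of the power is the product of
  \<open>m * real k\<close> and \<open>ln (1 - m) / m\<close>, which tend to \<open>t\<close> and to
  the derivative \<open>- 1\<close>.\<close>

lemma tendsto_one_minus_power_floor: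
  fixes t :: real
  assumes "t \<ge> 0"
  shows "((\<lambda>m::real. (1 - m) ^ nat \<lfloor>t / m\<rfloor>) \<longlongrightarrow> exp (- t)) (at_right 0)"
proof -
  have ev: "eventually (\<lambda>m::real. 0 < m \<and> m < 1) (at_right 0)"
    by (auto simp: eventually_at_right[of 0 1] intro!: exI[of _ 1])
  have floor: "t - m \<le> m * real (nat \<lfloor>t / m\<rfloor>) \<and> m * real (nat \<lfloor>t / m\<rfloor>) \<le> t" if "0 < m" for m :: real
  proof -
    have "real (nat \<lfloor>t / m\<rfloor>) = of_int \<lfloor>t / m\<rfloor>" using assms that by simp
    then have "t / m - 1 \<le> real (nat \<lfloor>t / m\<rfloor>)" "real (nat \<lfloor>t / m\<rfloor>) \<le> t / m" by linarith+
    then show ?thesis using that by (simp add: field_simps)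
  qed
  have "((\<lambda>m. m * real (nat \<lfloor>t / m\<rfloor>)) \<longlongrightarrow> t) (at_right 0)"
  proof (rule tendsto_sandwich)
    show "eventually (\<lambda>m. t - m \<le> m * real (nat \<lfloor>t / m\<rfloor>)) (at_right 0)"
      using ev by eventually_elim (use floor in auto)
    show "eventually (\<lambda>m. m * real (nat \<lfloor>t / m\<rfloor>) \<le> t) (at_right 0)"
      using ev by eventually_elim (use floor in auto)
    have "((\<lambda>m. t - m) \<longlongrightarrow> t - 0) (at_right 0)" by (intro tendsto_intros)
    then show "((\<lambda>m. t - m) \<longlongrightarrow> t) (at_right 0)" by simp
  qed auto
  moreover have "((\<lambda>m::real. ln (1 - m) / m) \<longlongrightarrow> - 1) (at_right 0)"
  proof -
    have "((\<lambda>m::real. ln (1 - m)) has_real_derivative - 1) (at 0)"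
      by (auto intro!: derivative_eq_intros)
    then have "((\<lambda>m::real. ln (1 - m) / m) \<longlongrightarrow> - 1) (at 0)"
      by (simp add: has_field_derivative_iff)
    then show ?thesis by (rule filterlim_mono) (simp_all add: at_le)
  qed
  ultimately have "((\<lambda>m. exp ((m * real (nat \<lfloor>t / m\<rfloor>)) * (ln (1 - m) / m))) \<longlongrightarrow> exp (t * - 1)) (at_right 0)"
    by (intro tendsto_intros)
  moreover have "eventually (\<lambda>m. exp ((m * real (nat \<lfloor>t / m\<rfloor>)) * (ln (1 - m) / m)) = (1 - m) ^ nat \<lfloor>t / m\<rfloor>) (at_right 0)"
    using ev by eventually_elim (simp add: exp_of_nat_mult)
  ultimately show ?thesis by (simp add: tendsto_cong)
qed

section \<open>Avoidance events and hitting times\<close>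

definition avoiding :: "('a \<Rightarrow> 'a) \<Rightarrow> 'a set \<Rightarrow> nat \<Rightarrow> 'a set" where
  "avoiding T A k = {x. \<forall>j\<in>{1..k}. (T ^^ j) x \<notin> A}"

lemma avoiding_antimono: "n \<le> k \<Longrightarrow> avoiding T A k \<subseteq> avoiding T A n"
  by (auto simp: avoiding_def)

lemma avoiding_gap:
  assumes "n \<le> k"
  shows "avoiding T A k = avoiding T A n \<inter> (T ^^ n) -` avoiding T A (k - n)"
proof -
  have "(\<forall>j\<in>{1..k}. (T ^^ j) x \<notin> A) \<longleftrightarrow> (\<forall>j\<in>{1..n}. (T ^^ j) x \<notin> A) \<and> (\<forall>j\<in>{1..k-n}. (T ^^ (j + n)) x \<notin> A)" for x
  proof (intro iffI conjI ballI)
    fix j assume *: "(\<forall>j\<in>{1..n}. (T ^^ j) x \<notin> A) \<and> (\<forall>j\<in>{1..k-n}. (T ^^ (j + n)) x \<notin> A)" "j \<in> {1..k}"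
    show "(T ^^ j) x \<notin> A"
    proof (cases "j \<le> n")
      case False
      then have "j - n \<in> {1..k-n}" "j - n + n = j" using *(2) by auto
      then show ?thesis using *(1) by metis
    qed (use * in auto)
  qed (use assms in auto)
  then show ?thesis by (auto simp: avoiding_def funpow_add)
qed

text \<open>Visit times are integers, so they exceed \<open>s\<close> exactly when they exceed its
  floor; if there is no visit, both sides hold.\<close>

lemma hitting_time_greater_iff:
  assumes "s \<ge> 0"
  shows "hitting_time T f r x x0 > ereal s \<longleftrightarrow> x \<in> avoiding T (f -` ball (f x0) r) (nat \<lfloor>s\<rfloor>)"
proof -
  define H where "H = {k::nat. k \<ge> 1 \<and> f ((T ^^ k) x) \<in> ball (f x0) r}"
  have nat_le: "k \<le> nat \<lfloor>s\<rfloor> \<longleftrightarrow> real k \<le> s" for k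
    using assms by (simp add: le_nat_floor le_nat_iff le_floor_iff)
  have av: "x \<in> avoiding T (f -` ball (f x0) r) (nat \<lfloor>s\<rfloor>) \<longleftrightarrow> (\<forall>k\<in>H. s < real k)"
    unfolding avoiding_def H_def using nat_le by (auto simp: not_less[symmetric])
  show ?thesis
  proof (cases "H = {}")
    case True
    then show ?thesis unfolding av hitting_time_def H_def[symmetric] by simp
  next
    case False
    have "s < real (Inf H) \<longleftrightarrow> (\<forall>k\<in>H. s < real k)"
      using Inf_nat_def1[OF False] wellorder_Inf_le1[of _ H] by (auto intro: less_le_trans)
    then show ?thesis unfolding av hitting_time_def H_def[symmetric] using False by simp
  qed
qed

section \<open>Avoidance probabilities under an invariant measure\<close>

locale measure_preserving = prob_space +
  fixes T :: "'a \<Rightarrow> 'a"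
  assumes T_measurable [measurable]: "T \<in> measurable M M"
    and T_invariant: "A \<in> sets M \<Longrightarrow> prob (T -` A \<inter> space M) = prob A"
begin

lemma T_power_measurable [measurable]: "T ^^ n \<in> measurable M M"
proof (induction n)
  case (Suc n)
  show ?case unfolding funpow.simps using Suc T_measurable by (rule measurable_comp)
qed (simp add: id_def)

lemma T_power_space: "x \<in> space M \<Longrightarrow> (T ^^ n) x \<in> space M"
  using T_power_measurable[of n] by (rule measurable_space)

lemma T_power_invariant: "A \<in> sets M \<Longrightarrow> prob ((T ^^ n) -` A \<inter> space M) = prob A"
proof (induction n)
  case (Suc n)
  have "(T ^^ Suc n) -` A \<inter> space M = T -` ((T ^^ n) -` A \<inter> space M) \<inter> space M"
    using measurable_space[OF T_measurable] by (auto simp: funpow_swap1)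
  then have "prob ((T ^^ Suc n) -` A \<inter> space M) = prob ((T ^^ n) -` A \<inter> space M)"
    using T_invariant[OF measurable_sets[OF T_power_measurable Suc.prems, of n]] by (simp only:)
  then show ?case using Suc by (simp only:)
qed (auto simp: Int_absorb2 sets.sets_into_space)

lemma sets_avoiding [measurable]:
  assumes [measurable]: "A \<in> sets M"
  shows "space M \<inter> avoiding T A k \<in> sets M"
proof -
  have "{x \<in> space M. \<forall>j\<in>{1..k}. (T ^^ j) x \<notin> A} \<in> sets M" by measurable
  then show ?thesis by (simp add: avoiding_def Int_def)
qed

text \<open>Avoiding \<open>A\<close> at times 1 to \<open>Suc k\<close> means that
  \<open>T x\<close> avoids it at times 0 to \<open>k\<close>. By invariance, the loss against
  \<open>k\<close> steps is the part of the avoiding set that lies in \<open>A\<close> at time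
  0.\<close>

lemma prob_avoiding_Suc:
  assumes [measurable]: "A \<in> sets M"
  shows "prob (space M \<inter> avoiding T A (Suc k)) = prob (space M \<inter> avoiding T A k) - prob (A \<inter> avoiding T A k)"
proof -
  let ?V = "space M \<inter> avoiding T A k"
  have A: "A \<subseteq> space M" using assms by (rule sets.sets_into_space)
  have "space M \<inter> avoiding T A (Suc k) = T -` (?V - A) \<inter> space M"
    unfolding avoiding_gap[of 1 "Suc k" T A, simplified]
    using measurable_space[OF T_measurable] by (auto simp: avoiding_def)
  then have "prob (space M \<inter> avoiding T A (Suc k)) = prob (?V - A)"
    using T_invariant[of "?V - A"] by simp
  also have "?V - A = ?V - (A \<inter> avoiding T A k)" by auto
  also have "prob \<dots> = prob ?V - prob (A \<inter> avoiding T A k)"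
  proof (rule finite_measure_Diff)
    have "A \<inter> avoiding T A k = A \<inter> ?V" using A by auto
    then show "A \<inter> avoiding T A k \<in> sets M" by simp
  qed (use A in auto)
  finally show ?thesis .
qed

text \<open>Each step adds an error of at most \<open>prob A * \<delta>\<close> and damps the
  earlier ones by \<open>1 - prob A\<close>. The geometric sum stays below \<open>\<delta>\<close>
  for all \<open>k\<close>, although the \<open>k\<close> of interest are of order
  \<open>1 / prob A\<close>.\<close>

lemma prob_avoiding_near_geometric:
  assumes A: "A \<in> sets M" "prob A > 0"
    and \<delta>: "\<And>k. \<bar>prob (A \<inter> avoiding T A k) / prob A - prob (space M \<inter> avoiding T A k)\<bar> \<le> \<delta>"
  shows "\<bar>prob (space M \<inter> avoiding T A k) - (1 - prob A) ^ k\<bar> \<le> \<delta> * (1 - (1 - prob A) ^ k)"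
proof (induction k)
  case 0
  then show ?case by (simp add: avoiding_def prob_space)
next
  case (Suc k)
  let ?p = "prob (space M \<inter> avoiding T A k)" and ?q = "prob (A \<inter> avoiding T A k) / prob A" and ?m = "prob A"
  let ?e = "(1 - ?m) ^ k"
  have "prob (space M \<inter> avoiding T A (Suc k)) - (1 - ?m) ^ Suc k = (1 - ?m) * (?p - ?e) - ?m * (?q - ?p)"
    using A by (simp add: prob_avoiding_Suc algebra_simps)
  also have "\<bar>\<dots>\<bar> \<le> (1 - ?m) * \<bar>?p - ?e\<bar> + ?m * \<bar>?q - ?p\<bar>"
    using abs_triangle_ineq4[of "(1 - ?m) * (?p - ?e)" "?m * (?q - ?p)"]
    by (simp add: abs_mult)
  also have "\<dots> \<le> (1 - ?m) * (\<delta> * (1 - ?e)) + ?m * \<delta>"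
    using Suc \<delta>[of k] by (intro add_mono mult_left_mono) auto
  also have "\<dots> = \<delta> * (1 - (1 - ?m) ^ Suc k)" by (simp add: algebra_simps)
  finally show ?case .
qed

lemma prob_hit_le:
  assumes [measurable]: "A \<in> sets M"
  shows "prob (space M - avoiding T A n) \<le> real n * prob A"
proof -
  have "space M - avoiding T A n = (\<Union>j\<in>{1..n}. (T ^^ j) -` A \<inter> space M)"
    by (auto simp: avoiding_def)
  also have "prob \<dots> \<le> (\<Sum>j\<in>{1..n}. prob ((T ^^ j) -` A \<inter> space M))"
    by (intro finite_measure_subadditive_finite) auto
  also have "\<dots> = real n * prob A" using T_power_invariant by simp
  finally show ?thesis .
qed

text \<open>A gap of \<open>n\<close> steps is inserted. Ignoring visits at times 1 to
  \<open>n\<close> costs at most \<open>prob (A - avoiding T A n)\<close> within \<open>A\<close>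
  and \<open>real n * prob A\<close> on the whole space; then only \<open>A\<close> and a preimage
  under \<open>T ^^ n\<close> have to be decorrelated, at cost \<open>\<eta>\<close>.\<close>

lemma conditional_avoiding_near_avoiding:
  assumes A [measurable]: "A \<in> sets M" "prob A > 0"
    and \<eta>: "\<And>E. E \<in> sets M \<Longrightarrow> \<bar>prob (A \<inter> (T ^^ n) -` E) - prob A * prob E\<bar> \<le> \<eta>"
  shows "\<bar>prob (A \<inter> avoiding T A k) / prob A - prob (space M \<inter> avoiding T A k)\<bar>
    \<le> (prob (A - avoiding T A n) + \<eta>) / prob A + real n * prob A"
proof -
  let ?m = "prob A" and ?\<sigma> = "prob (A - avoiding T A n)"
  let ?a = "prob (A \<inter> avoiding T A k)" and ?p = "prob (space M \<inter> avoiding T A k)"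
  have sub: "A \<subseteq> space M" using A(1) by (rule sets.sets_into_space)
  have Aset: "A \<inter> avoiding T A i \<in> sets M" "A - avoiding T A i \<in> sets M" "space M - avoiding T A i \<in> sets M" for i
  proof -
    have "A \<inter> avoiding T A i = A \<inter> (space M \<inter> avoiding T A i)"
      "A - avoiding T A i = A - (space M \<inter> avoiding T A i)"
      "space M - avoiding T A i = space M - (space M \<inter> avoiding T A i)" using sub by auto
    then show "A \<inter> avoiding T A i \<in> sets M" "A - avoiding T A i \<in> sets M" "space M - avoiding T A i \<in> sets M"
      by simp_all
  qed
  have \<eta>0: "\<eta> \<ge> 0" using \<eta>[of "space M"] by auto
  have hit: "prob (space M - avoiding T A n) \<le> real n * ?m" using A(1) by (rule prob_hit_le)
  have "\<bar>?a - ?m * ?p\<bar> \<le> ?\<sigma> + \<eta> + ?m * (real n * ?m)"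
  proof (cases "n \<le> k")
    \<comment> \<open>No gap fits when \<open>k < n\<close>, but then both avoidance probabilities
      are near 1, and their deficits are at most the early-return and hitting terms.\<close>
    case False
    then have "avoiding T A n \<subseteq> avoiding T A k" by (simp add: avoiding_antimono)
    then have sup: "?m \<le> prob ((A \<inter> avoiding T A k) \<union> (A - avoiding T A n))"
      "1 \<le> prob ((space M \<inter> avoiding T A k) \<union> (space M - avoiding T A n))"
      using Aset by (auto simp: prob_space[symmetric] intro!: finite_measure_mono)
    note sup(1)
    also have "prob ((A \<inter> avoiding T A k) \<union> (A - avoiding T A n)) \<le> ?a + ?\<sigma>"
      using Aset by (intro measure_Un_le) auto
    finally have 1: "?m \<le> ?a + ?\<sigma>" .
    note sup(2)
    also have "prob ((space M \<inter> avoiding T A k) \<union> (space M - avoiding T A n)) \<le> ?p + prob (space M - avoiding T A n)"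
      using Aset by (intro measure_Un_le) auto
    finally have "1 - real n * ?m \<le> ?p" using hit by linarith
    then have "?m * (1 - real n * ?m) \<le> ?m * ?p" "?m * ?p \<le> ?m"
      by (auto intro!: mult_left_mono mult_left_le)
    moreover have "?a \<le> ?m" using A(1) by (intro finite_measure_mono) auto
    moreover have "?m * (real n * ?m) \<ge> 0" "?\<sigma> \<ge> 0" by simp_all
    moreover have "?m * (1 - real n * ?m) = ?m - ?m * (real n * ?m)" by (simp add: right_diff_distrib)
    ultimately show ?thesis using 1 \<eta>0 unfolding abs_le_iff by linarith
  next
    case True
    define V where "V = space M \<inter> avoiding T A (k - n)"
    define U where "U = (T ^^ n) -` V \<inter> space M"
    have V [measurable]: "V \<in> sets M" unfolding V_def by simp
    have U [measurable]: "U \<in> sets M" unfolding U_def by simp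
    have PU: "prob U = prob V" unfolding U_def using V by (rule T_power_invariant)
    have split: "space M \<inter> avoiding T A k = U \<inter> avoiding T A n"
      unfolding avoiding_gap[OF True] U_def V_def using T_power_space by auto
    have AU: "A \<inter> (T ^^ n) -` V = A \<inter> U" using sub by (auto simp: U_def)
    have splitA: "A \<inter> avoiding T A k = (A \<inter> U) \<inter> avoiding T A n" using split sub by blast
    have "?a \<le> prob (A \<inter> U)" unfolding splitA by (intro finite_measure_mono) auto
    moreover have "prob (A \<inter> U) \<le> prob ((A \<inter> avoiding T A k) \<union> (A - avoiding T A n))"
    proof (rule finite_measure_mono)
      show "A \<inter> U \<subseteq> A \<inter> avoiding T A k \<union> (A - avoiding T A n)" unfolding splitA by auto
      show "A \<inter> avoiding T A k \<union> (A - avoiding T A n) \<in> sets M" using Aset by auto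
    qed
    moreover have "\<dots> \<le> ?a + ?\<sigma>" using Aset by (intro measure_Un_le) auto
    moreover have "\<bar>prob (A \<inter> U) - ?m * prob V\<bar> \<le> \<eta>" using \<eta>[OF V] unfolding AU .
    moreover have "?m * ?p \<le> ?m * prob V"
      unfolding split PU[symmetric] by (intro mult_left_mono finite_measure_mono) auto
    moreover have "?m * prob V \<le> ?m * (?p + real n * ?m)"
    proof (rule mult_left_mono)
      have "prob U \<le> prob ((space M \<inter> avoiding T A k) \<union> (space M - avoiding T A n))"
      proof (rule finite_measure_mono)
        show "U \<subseteq> space M \<inter> avoiding T A k \<union> (space M - avoiding T A n)"
          unfolding split using sets.sets_into_space[OF U] by auto
        show "space M \<inter> avoiding T A k \<union> (space M - avoiding T A n) \<in> sets M" using Aset by auto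
      qed
      also have "\<dots> \<le> ?p + prob (space M - avoiding T A n)"
        using Aset by (intro measure_Un_le) auto
      finally show "prob V \<le> ?p + real n * ?m" using hit PU by linarith
    qed simp
    ultimately show ?thesis by (simp add: distrib_left)
  qed
  moreover have "?a / ?m - ?p = (?a - ?m * ?p) / ?m" using A(2) by (simp add: field_simps)
  then have "\<bar>?a / ?m - ?p\<bar> = \<bar>?a - ?m * ?p\<bar> / ?m" using A(2) by simp
  ultimately show ?thesis using A(2) by (simp add: field_simps)
qed

end

section \<open>Decay of correlations for observed balls\<close>

text \<open>A Lipschitz function between the indicators of the balls of radius
  \<open>r - \<rho>\<close> and \<open>r\<close>. A thin layer \<open>\<rho>\<close> costs a
  Lipschitz constant \<open>1 / \<rho>\<close>; the trade-off is settled in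
  \<open>hitting_statistics_limit\<close>.\<close>

definition tent :: "'b::metric_space \<Rightarrow> real \<Rightarrow> real \<Rightarrow> 'b \<Rightarrow> real" where
  "tent y r \<rho> w = max 0 (min 1 ((r - dist y w) / \<rho>))"

lemma tent_bounds: "0 \<le> tent y r \<rho> w" "tent y r \<rho> w \<le> 1"
  by (auto simp: tent_def)

lemma tent_eq_1: "\<rho> > 0 \<Longrightarrow> w \<in> ball y (r - \<rho>) \<Longrightarrow> tent y r \<rho> w = 1"
  by (auto simp: tent_def field_simps)

lemma tent_eq_0: "\<rho> > 0 \<Longrightarrow> w \<notin> ball y r \<Longrightarrow> tent y r \<rho> w = 0"
  by (auto simp: tent_def field_simps not_less divide_nonpos_pos)

lemma tent_lipschitz:
  assumes "\<rho> > 0"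
  shows "(1 / \<rho>)-lipschitz_on UNIV (tent y r \<rho>)"
proof (rule lipschitz_onI)
  fix v w :: 'a
  have "\<bar>tent y r \<rho> v - tent y r \<rho> w\<bar> \<le> \<bar>(r - dist y v) / \<rho> - (r - dist y w) / \<rho>\<bar>"
    unfolding tent_def by linarith
  also have "\<dots> = \<bar>dist y w - dist y v\<bar> / \<rho>"
    using assms by (simp flip: diff_divide_distrib)
  also have "\<dots> \<le> dist v w / \<rho>"
    using assms abs_dist_diff_le[of w y v] by (intro divide_right_mono) (auto simp: dist_commute)
  finally show "dist (tent y r \<rho> v) (tent y r \<rho> w) \<le> 1 / \<rho> * dist v w" by (simp add: dist_real_def)
qed (use assms in simp)

lemma borel_measurable_tent [measurable]: "\<rho> > 0 \<Longrightarrow> tent y r \<rho> \<in> borel_measurable borel"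
  by (intro borel_measurable_continuous_onI lipschitz_on_continuous_on[OF tent_lipschitz])

text \<open>Only indicator functions occur as second observable, so the sup norm disappears from
  \<open>decay\<close>; nonnegative \<open>\<theta>\<close> allows any Lipschitz constant
  \<open>C\<close> in place of the least one.\<close>

locale observed_system = measure_preserving M T
  for M :: "'a::metric_space measure" and T +
  fixes f :: "'a \<Rightarrow> real^'n" and L :: real and \<theta> :: "nat \<Rightarrow> real"
  assumes f_measurable [measurable]: "f \<in> borel_measurable M"
    and f_lipschitz: "L-lipschitz_on UNIV f"
    and \<theta>_nonneg: "\<theta> n \<ge> 0"
    and \<theta>_decay: "p > 0 \<Longrightarrow> (\<lambda>n. \<theta> n * real n powr p) \<longlonglongrightarrow> 0"
    and decay: "\<lbrakk>C-lipschitz_on UNIV \<psi>; E \<in> sets M; n \<ge> 1\<rbrakk> \<Longrightarrow>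
      \<bar>(\<integral>x. \<psi> x * indicator E ((T ^^ n) x) \<partial>M) - (\<integral>x. \<psi> x \<partial>M) * prob E\<bar> \<le> C * \<theta> n"
    and aperiodic: "AE x in M. \<forall>n\<ge>1. f ((T ^^ n) x) \<noteq> f x"
begin

abbreviation obs_ball :: "real^'n \<Rightarrow> real \<Rightarrow> 'a set" where
  "obs_ball y r \<equiv> space M \<inter> f -` ball y r"

lemma sets_obs_ball [measurable]: "obs_ball y r \<in> sets M"
  by (rule sets_Int_vimage_ball) auto

lemma L_nonneg: "L \<ge> 0" using f_lipschitz by (rule lipschitz_on_nonneg)

lemma decay_tent:
  assumes "\<rho> > 0" "E \<in> sets M" "n \<ge> 1"
  shows "\<bar>(\<integral>x. tent y r \<rho> (f x) * indicator E ((T ^^ n) x) \<partial>M) - (\<integral>x. tent y r \<rho> (f x) \<partial>M) * prob E\<bar>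
    \<le> L / \<rho> * \<theta> n"
proof -
  have "(1 / \<rho> * L)-lipschitz_on UNIV (\<lambda>x. tent y r \<rho> (f x))"
    using lipschitz_on_compose2[OF f_lipschitz, of "1 / \<rho>" "tent y r \<rho>"] 
      lipschitz_on_subset[OF tent_lipschitz[OF assms(1)]] by blast
  from decay[OF this assms(2,3)] show ?thesis by simp
qed

lemma integrable_tent [simp]:
  assumes "\<rho> > 0"
  shows "integrable M (\<lambda>x. tent y r \<rho> (f x))"
proof (rule integrable_const_bound[where B = 1])
  show "(\<lambda>x. tent y r \<rho> (f x)) \<in> borel_measurable M" using assms by measurable
qed (auto simp: tent_bounds)

lemma integrable_tent_indicator [simp]:
  assumes "\<rho> > 0" and [measurable]: "E \<in> sets M"
  shows "integrable M (\<lambda>x. tent y r \<rho> (f x) * indicator E ((T ^^ n) x))"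
proof (rule integrable_const_bound[where B = 1])
  show "(\<lambda>x. tent y r \<rho> (f x) * indicator E ((T ^^ n) x)) \<in> borel_measurable M"
    using assms by measurable
qed (auto simp: tent_bounds indicator_def)

lemma sets_vimage_T_power: "A \<in> sets M \<Longrightarrow> E \<in> sets M \<Longrightarrow> A \<inter> (T ^^ n) -` E \<in> sets M"
proof -
  assume *: "A \<in> sets M" "E \<in> sets M"
  then have "A \<inter> (T ^^ n) -` E = A \<inter> ((T ^^ n) -` E \<inter> space M)" using sets.sets_into_space by blast
  then show ?thesis using * measurable_sets[OF T_power_measurable] by auto
qed

text \<open>For an upper bound the tent may lie above the indicator, at the price of a radius larger
  by \<open>\<rho>\<close>. No annulus term arises, so the estimate is usable at every centre
  \<open>y\<close>.\<close>

lemma prob_ball_and_later_le: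
  assumes "\<rho> > 0" and E: "E \<in> sets M" and "n \<ge> 1"
  shows "prob (obs_ball y r \<inter> (T ^^ n) -` E) \<le> prob (obs_ball y (r + \<rho>)) * prob E + L / \<rho> * \<theta> n"
proof -
  let ?\<psi> = "\<lambda>x. tent y (r + \<rho>) \<rho> (f x)"
  have "prob (obs_ball y r \<inter> (T ^^ n) -` E) = (\<integral>x. indicator (obs_ball y r \<inter> (T ^^ n) -` E) x \<partial>M)"
    using sets_vimage_T_power[OF sets_obs_ball E] by simp
  also have "\<dots> \<le> (\<integral>x. ?\<psi> x * indicator E ((T ^^ n) x) \<partial>M)"
  proof (rule integral_mono)
    fix x assume "x \<in> space M"
    show "indicator (obs_ball y r \<inter> (T ^^ n) -` E) x \<le> ?\<psi> x * indicator E ((T ^^ n) x)"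
      using tent_eq_1[OF assms(1), of "f x" y "r + \<rho>"] by (auto simp: tent_bounds indicator_def)
  qed (use assms(1) E sets_vimage_T_power[OF sets_obs_ball E] in \<open>auto simp: emeasure_eq_measure\<close>)
  also have "\<dots> \<le> (\<integral>x. ?\<psi> x \<partial>M) * prob E + L / \<rho> * \<theta> n"
    using decay_tent[OF assms, of y "r + \<rho>"] by linarith
  also have "(\<integral>x. ?\<psi> x \<partial>M) \<le> (\<integral>x. indicator (obs_ball y (r + \<rho>)) x \<partial>M)"
  proof (rule integral_mono)
    fix x assume "x \<in> space M"
    then show "?\<psi> x \<le> indicator (obs_ball y (r + \<rho>)) x"
      using tent_eq_0[OF assms(1), of "f x" y "r + \<rho>"] by (auto simp: tent_bounds indicator_def)
  qed (use assms(1) in \<open>auto simp: emeasure_eq_measure\<close>)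
  also have "\<dots> = prob (obs_ball y (r + \<rho>))" by simp
  finally show ?thesis by (simp add: mult_right_mono)
qed

text \<open>Tent and indicator of the ball differ only on the annulus. Exchanging them once in the
  joint integral and once in the product gives the factor 2.\<close>

lemma decay_obs_ball:
  assumes "\<rho> > 0" and E: "E \<in> sets M" and "n \<ge> 1"
  shows "\<bar>prob (obs_ball y r \<inter> (T ^^ n) -` E) - prob (obs_ball y r) * prob E\<bar>
    \<le> 2 * prob (obs_ball y r - obs_ball y (r - \<rho>)) + L / \<rho> * \<theta> n"
proof -
  let ?\<psi> = "\<lambda>x. tent y r \<rho> (f x)"
  let ?A = "obs_ball y r" and ?D = "obs_ball y r - obs_ball y (r - \<rho>)"
  have near: "indicator ?A x - indicator ?D x \<le> ?\<psi> x" "?\<psi> x \<le> indicator ?A x" if "x \<in> space M" for x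
    using that tent_eq_1[OF assms(1), of "f x" y r] tent_eq_0[OF assms(1), of "f x" y r]
    by (auto simp: indicator_def tent_bounds)
  have meas: "?A \<inter> (T ^^ n) -` E \<in> sets M" by (rule sets_vimage_T_power[OF sets_obs_ball E])
  have 1: "(\<integral>x. ?\<psi> x * indicator E ((T ^^ n) x) \<partial>M) \<le> prob (?A \<inter> (T ^^ n) -` E)"
  proof -
    have "(\<integral>x. ?\<psi> x * indicator E ((T ^^ n) x) \<partial>M) \<le> (\<integral>x. indicator (?A \<inter> (T ^^ n) -` E) x \<partial>M)"
    proof (rule integral_mono)
      fix x assume x: "x \<in> space M"
      show "?\<psi> x * indicator E ((T ^^ n) x) \<le> indicator (?A \<inter> (T ^^ n) -` E) x"
        using near(2)[OF x] by (cases "(T ^^ n) x \<in> E") (auto simp: indicator_def)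
    qed (use assms(1) E meas in \<open>auto simp: emeasure_eq_measure\<close>)
    then show ?thesis using meas by simp
  qed
  have 2: "prob (?A \<inter> (T ^^ n) -` E) - prob ?D \<le> (\<integral>x. ?\<psi> x * indicator E ((T ^^ n) x) \<partial>M)"
  proof -
    have "(\<integral>x. indicator (?A \<inter> (T ^^ n) -` E) x - indicator ?D x \<partial>M) \<le> (\<integral>x. ?\<psi> x * indicator E ((T ^^ n) x) \<partial>M)"
    proof (rule integral_mono)
      fix x assume x: "x \<in> space M"
      show "indicator (?A \<inter> (T ^^ n) -` E) x - indicator ?D x \<le> ?\<psi> x * indicator E ((T ^^ n) x)"
        using near(1)[OF x] by (cases "(T ^^ n) x \<in> E") (auto simp: indicator_def)
    qed (use assms(1) E meas in \<open>auto simp: emeasure_eq_measure\<close>)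
    moreover have "(\<integral>x. indicator (?A \<inter> (T ^^ n) -` E) x - indicator ?D x \<partial>M) = prob (?A \<inter> (T ^^ n) -` E) - prob ?D"
      using meas by (subst Bochner_Integration.integral_diff) (auto simp: emeasure_eq_measure)
    ultimately show ?thesis by simp
  qed
  have 3: "(\<integral>x. ?\<psi> x \<partial>M) \<le> prob ?A"
  proof -
    have "(\<integral>x. ?\<psi> x \<partial>M) \<le> (\<integral>x. indicator ?A x \<partial>M)"
      using assms(1) near(2) by (intro integral_mono) (auto simp: emeasure_eq_measure)
    then show ?thesis by simp
  qed
  have 4: "prob ?A - prob ?D \<le> (\<integral>x. ?\<psi> x \<partial>M)"
  proof -
    have "(\<integral>x. indicator ?A x - indicator ?D x \<partial>M) \<le> (\<integral>x. ?\<psi> x \<partial>M)"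
      using assms(1) near(1) by (intro integral_mono) (auto simp: emeasure_eq_measure)
    moreover have "(\<integral>x. indicator ?A x - indicator ?D x \<partial>M) = prob ?A - prob ?D"
      by (subst Bochner_Integration.integral_diff) (auto simp: emeasure_eq_measure)
    ultimately show ?thesis by simp
  qed
  have 5: "(\<integral>x. ?\<psi> x \<partial>M) * prob E \<le> prob ?A * prob E" using 3 by (simp add: mult_right_mono)
  have "(prob ?A - prob ?D) * prob E \<le> (\<integral>x. ?\<psi> x \<partial>M) * prob E" using 4 by (simp add: mult_right_mono)
  moreover have "prob ?D * prob E \<le> prob ?D" by (simp add: mult_left_le)
  ultimately have 6: "prob ?A * prob E - prob ?D \<le> (\<integral>x. ?\<psi> x \<partial>M) * prob E" by (simp add: left_diff_distrib)
  show ?thesis using 1 2 5 6 decay_tent[OF assms, of y r] by linarith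
qed

text \<open>Near a centre \<open>y\<close> of the cover, \<open>f x\<close> lies within
  \<open>\<rho>\<close> and its value at time \<open>j\<close> within \<open>3 * \<rho>\<close> of
  \<open>y\<close>. Decay makes the two events nearly independent, and the second has mass at most
  \<open>\<beta>\<close> because \<open>y\<close> is itself a value of \<open>f\<close> on
  \<open>G\<close>. The masses of the first, taken at radius \<open>2 * \<rho>\<close>, sum to at
  most an overlap number; the mixing errors are multiplied by the number of centres.\<close>

lemma prob_close_return_le:
  assumes "\<rho> > 0" "R \<ge> 0" "\<beta> \<ge> 0" "j \<ge> 1"
  defines "G \<equiv> {x \<in> space M. norm (f x) < R \<and> prob (obs_ball (f x) (3 * \<rho>)) \<le> \<beta> \<and> dist (f ((T ^^ j) x)) (f x) < 2 * \<rho>}"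
  shows sets_close_return: "G \<in> sets M"
    and "prob G \<le> \<beta> * (4 * real CARD('n) + 2) ^ CARD('n)
      + (2 * real CARD('n) * R / \<rho> + 2) ^ CARD('n) * (L / \<rho> * \<theta> j)"
proof -
  let ?N = "real CARD('n)"
  note [measurable] = borel_measurable_prob_ball[OF f_measurable sets.top]
  show G: "G \<in> sets M" unfolding G_def by measurable
  have "f ` G \<subseteq> ball 0 R" by (auto simp: G_def)
  then obtain Y where Y: "finite Y" "Y \<subseteq> f ` G" "\<And>x x'. \<lbrakk>x \<in> Y; x' \<in> Y; x \<noteq> x'\<rbrakk> \<Longrightarrow> dist x x' \<ge> \<rho>"
    "real (card Y) \<le> (2 * ?N * R / \<rho> + 2) ^ CARD('n)"
    "prob G \<le> (\<Sum>y\<in>Y. prob (G \<inter> f -` ball y \<rho>))"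
    using prob_le_sum_balls[OF f_measurable G _ assms(2,1)] by metis
  have "prob (G \<inter> f -` ball y \<rho>) \<le> prob (obs_ball y (2 * \<rho>)) * \<beta> + L / \<rho> * \<theta> j" if "y \<in> Y" for y
  proof -
    have "G \<inter> f -` ball y \<rho> \<subseteq> obs_ball y \<rho> \<inter> (T ^^ j) -` obs_ball y (3 * \<rho>)"
    proof
      fix x assume x: "x \<in> G \<inter> f -` ball y \<rho>"
      then have "x \<in> space M" "(T ^^ j) x \<in> space M" "dist (f ((T ^^ j) x)) (f x) < 2 * \<rho>"
        by (auto simp: G_def T_power_space)
      moreover from this have "f ((T ^^ j) x) \<in> ball y (3 * \<rho>)"
        using x dist_triangle[of y "f ((T ^^ j) x)" "f x"] by (simp add: dist_commute)
      ultimately show "x \<in> obs_ball y \<rho> \<inter> (T ^^ j) -` obs_ball y (3 * \<rho>)" using x by simp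
    qed
    then have "prob (G \<inter> f -` ball y \<rho>) \<le> prob (obs_ball y \<rho> \<inter> (T ^^ j) -` obs_ball y (3 * \<rho>))"
      by (intro finite_measure_mono sets_vimage_T_power) auto
    also have "\<dots> \<le> prob (obs_ball y (\<rho> + \<rho>)) * prob (obs_ball y (3 * \<rho>)) + L / \<rho> * \<theta> j"
      using assms by (intro prob_ball_and_later_le) auto
    also have "prob (obs_ball y (\<rho> + \<rho>)) * prob (obs_ball y (3 * \<rho>)) \<le> prob (obs_ball y (\<rho> + \<rho>)) * \<beta>"
      using Y(2) that by (intro mult_left_mono) (auto simp: G_def)
    finally show ?thesis by simp
  qed
  then have "prob G \<le> (\<Sum>y\<in>Y. prob (obs_ball y (2 * \<rho>)) * \<beta> + L / \<rho> * \<theta> j)"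
    using Y(5) by (meson order_trans sum_mono)
  also have "\<dots> = \<beta> * (\<Sum>y\<in>Y. prob (obs_ball y (2 * \<rho>))) + real (card Y) * (L / \<rho> * \<theta> j)"
    by (simp add: sum.distrib sum_distrib_left mult.commute)
  also have "\<dots> \<le> \<beta> * (4 * ?N + 2) ^ CARD('n) + (2 * ?N * R / \<rho> + 2) ^ CARD('n) * (L / \<rho> * \<theta> j)"
  proof (intro add_mono mult_left_mono mult_right_mono)
    have "(\<Sum>y\<in>Y. prob (obs_ball y (2 * \<rho>))) \<le> (4 * ?N + 2) ^ CARD('n) * prob (space M)"
    proof (rule sum_prob_le_overlap[OF Y(1)])
      fix w
      have "real (card {y \<in> Y. w \<in> obs_ball y (2 * \<rho>)}) \<le> (2 * ?N * (2 * \<rho>) / \<rho> + 2) ^ CARD('n)"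
        using Y(3) assms(1) by (intro card_separated_le[where z = "f w"]) (auto simp: dist_commute)
      then show "real (card {y \<in> Y. w \<in> obs_ball y (2 * \<rho>)}) \<le> (4 * ?N + 2) ^ CARD('n)"
        using assms(1) by simp
    qed auto
    then show "(\<Sum>y\<in>Y. prob (obs_ball y (2 * \<rho>))) \<le> (4 * ?N + 2) ^ CARD('n)" by (simp add: prob_space)
  qed (use Y(4) assms L_nonneg \<theta>_nonneg in auto)
  finally show "prob G \<le> \<beta> * (4 * ?N + 2) ^ CARD('n) + (2 * ?N * R / \<rho> + 2) ^ CARD('n) * (L / \<rho> * \<theta> j)" .
qed

end

section \<open>Mass of balls and early returns\<close>

context prob_space
begin

text \<open>Borel-Cantelli along dyadic radii \<rho>: the points with ball mass below \<rho>^(N+1)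
  are covered by order \<rho>^(-N) such balls, hence have total mass of order \<rho>. One more power
  of \<open>r\<close> pays for the passage to arbitrary radii.\<close>

lemma AE_mass_of_ball_ge:
  fixes f :: "'a \<Rightarrow> real^'n"
  assumes [measurable]: "f \<in> borel_measurable M"
  shows "AE x in M. eventually (\<lambda>r. r ^ (CARD('n) + 2) \<le> prob (space M \<inter> f -` ball (f x) r)) (at_right 0)"
proof -
  let ?N = "CARD('n)"
  define E where "E R k = {x \<in> space M. norm (f x) < real R \<and>
    prob (space M \<inter> f -` ball (f x) ((1/2)^k)) < ((1/2)^k) ^ (?N + 1)}" for R k :: nat
  note [measurable] = borel_measurable_prob_ball[OF assms sets.top]
  have sets: "E R k \<in> sets M" for R k unfolding E_def by measurable
  have bound: "prob (E R k) \<le> (2 * real ?N * real R + 2) ^ ?N * (1/2)^k" for R k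
  proof -
    let ?\<rho> = "(1/2)^k :: real"
    have "f ` E R k \<subseteq> ball 0 (real R)" by (auto simp: E_def)
    then obtain Y where Y: "finite Y" "Y \<subseteq> f ` E R k"
      "real (card Y) \<le> (2 * real ?N * real R / ?\<rho> + 2) ^ ?N"
      "prob (E R k) \<le> (\<Sum>y\<in>Y. prob (E R k \<inter> f -` ball y ?\<rho>))"
      by (rule prob_le_sum_balls[OF assms sets, of R k "real R" ?\<rho>]) auto
    have "prob (E R k \<inter> f -` ball y ?\<rho>) \<le> ?\<rho> ^ (?N + 1)" if "y \<in> Y" for y
    proof -
      have "prob (E R k \<inter> f -` ball y ?\<rho>) \<le> prob (space M \<inter> f -` ball y ?\<rho>)"
        by (intro finite_measure_mono sets_Int_vimage_ball) (auto simp: E_def)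
      also have "\<dots> \<le> ?\<rho> ^ (?N + 1)" using that Y(2) by (auto simp: E_def)
      finally show ?thesis .
    qed
    then have "prob (E R k) \<le> real (card Y) * ?\<rho> ^ (?N + 1)"
      using order_trans[OF Y(4) sum_bounded_above] by blast
    also have "\<dots> \<le> (2 * real ?N * real R / ?\<rho> + 2) ^ ?N * ?\<rho> ^ (?N + 1)"
      using Y(3) by (intro mult_right_mono) auto
    also have "\<dots> = ((2 * real ?N * real R / ?\<rho> + 2) * ?\<rho>) ^ ?N * ?\<rho>"
      by (simp only: power_mult_distrib power_add power_one_right mult.assoc)
    also have "(2 * real ?N * real R / ?\<rho> + 2) * ?\<rho> = 2 * real ?N * real R + 2 * ?\<rho>"
      by (simp add: field_simps)
    also have "(2 * real ?N * real R + 2 * ?\<rho>) ^ ?N * ?\<rho> \<le> (2 * real ?N * real R + 2) ^ ?N * ?\<rho>"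
      by (intro mult_right_mono power_mono) (auto simp: power_le_one)
    finally show ?thesis .
  qed
  have "AE x in M. eventually (\<lambda>k. x \<in> space M - E R k) sequentially" for R
  proof (rule borel_cantelli_AE1)
    have "summable (\<lambda>k. (2 * real ?N * real R + 2) ^ ?N * (1/2)^k :: real)"
      by (intro summable_mult summable_geometric) simp
    then show "summable (\<lambda>k. measure M (E R k))"
      by (rule summable_comparison_test'[where N = 0]) (use bound in auto)
  qed (use sets in \<open>auto simp: emeasure_eq_measure\<close>)
  then have "AE x in M. \<forall>R. eventually (\<lambda>k. x \<in> space M - E R k) sequentially"
    by (simp add: AE_all_countable)
  then show ?thesis
  proof (rule AE_mp, intro AE_I2 impI)
    fix x assume x: "x \<in> space M" "\<forall>R. eventually (\<lambda>k. x \<in> space M - E R k) sequentially"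
    obtain R where R: "norm (f x) < real R" using reals_Archimedean2 by blast
    obtain k0 where k0: "\<And>k. k \<ge> k0 \<Longrightarrow> x \<notin> E R k" using x(2) by (force simp: eventually_sequentially)
    have large: "((1/2)^k) ^ (?N + 1) \<le> prob (space M \<inter> f -` ball (f x) ((1/2)^k))" if "k \<ge> k0" for k
      using k0[OF that] x(1) R by (auto simp: E_def)
    \<comment> \<open>Below the first bound the dyadic estimate applies; below the second, one
      factor \<open>r\<close> absorbs the power of 2 lost by rounding \<open>r\<close> down to a
      dyadic radius.\<close>
    define b where "b = min ((1/2)^k0) ((1/2)^(?N + 1) :: real)"
    have "r ^ (?N + 2) \<le> prob (space M \<inter> f -` ball (f x) r)" if r: "0 < r" "r < b" for r
    proof -
      have ex: "\<exists>k. (1/2)^k \<le> r" using real_arch_pow_inv[of r "1/2"] r(1) by (auto intro: less_imp_le)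
      define k where "k = (LEAST k. (1/2)^k \<le> r)"
      have k: "(1/2)^k \<le> r" unfolding k_def using ex by (rule LeastI_ex)
      have "k > k0"
      proof (rule ccontr)
        assume "\<not> k > k0"
        then have "(1/2)^k0 \<le> ((1/2)^k :: real)" by (intro power_decreasing) auto
        moreover have "r < (1/2)^k0" using r(2) by (simp add: b_def)
        ultimately show False using k by linarith
      qed
      then obtain k' where k': "k = Suc k'" by (cases k) auto
      have "\<not> (1/2)^k' \<le> r" using not_less_Least[of k' "\<lambda>k. (1/2)^k \<le> r"] k' by (simp add: k_def)
      then have "r / 2 \<le> (1/2)^k" by (simp add: k')
      have "r ^ (?N + 2) = r ^ (?N + 1) * r" by simp
      also have "\<dots> \<le> r ^ (?N + 1) * (1/2)^(?N + 1)" using r by (intro mult_left_mono) (auto simp: b_def)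
      also have "\<dots> = (r / 2) ^ (?N + 1)" by (metis power_mult_distrib times_divide_eq_right mult.right_neutral)
      also have "\<dots> \<le> ((1/2)^k) ^ (?N + 1)" using r \<open>r / 2 \<le> (1/2)^k\<close> by (intro power_mono) auto
      also have "\<dots> \<le> prob (space M \<inter> f -` ball (f x) ((1/2)^k))" using \<open>k > k0\<close> by (intro large) simp
      also have "\<dots> \<le> prob (space M \<inter> f -` ball (f x) r)"
        using k by (intro finite_measure_mono sets_Int_vimage_ball) auto
      finally show ?thesis .
    qed
    moreover have "b > 0" by (simp add: b_def)
    ultimately show "eventually (\<lambda>r. r ^ (?N + 2) \<le> prob (space M \<inter> f -` ball (f x) r)) (at_right 0)"
      unfolding eventually_at_right[OF zero_less_one] by blast
  qed
qed

end

section \<open>Close returns: a summable bound for late times, aperiodicity for early ones\<close>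

context observed_system
begin

text \<open>The value of \<open>q\<close> is dictated by summability: a mass bound of exponent
  \<open>1 / real (Suc i)\<close> at scale \<open>1 / real j ^ q\<close> is a multiple of
  \<open>1 / real j ^ 2\<close>. The mixing error loses only a power of \<open>j\<close>, which
  \<open>\<theta>\<close> compensates.\<close>

lemma prob_close_return_le_inverse_square:
  fixes i :: nat
  defines "q \<equiv> 2 * Suc i"
  obtains K where "\<And>j. j \<ge> 1 \<Longrightarrow>
    prob {x \<in> space M. norm (f x) < real (Suc i) \<and>
      prob (obs_ball (f x) (3 * (1 / real j ^ q))) \<le> (4 * (1 / real j ^ q)) powr (1 / real (Suc i)) \<and>
      dist (f ((T ^^ j) x)) (f x) < 2 * (1 / real j ^ q)} \<le> K * (1 / real j ^ 2)"
proof -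
  let ?N = "CARD('n)" and ?R = "real (Suc i)"
  \<comment> \<open>The number of centres contributes the power \<open>q * ?N\<close> of
    \<open>j\<close> and the Lipschitz constant the power \<open>q\<close>; the remaining 2 leaves a
    summable term.\<close>
  define p where "p = q * (?N + 1) + 2"
  have "p > 0" by (simp add: p_def)
  then have "Bseq (\<lambda>n. \<theta> n * real n powr real p)"
    using \<theta>_decay[of "real p"] by (intro convergent_imp_Bseq convergentI) auto
  then obtain B where B: "B > 0" "\<And>n. norm (\<theta> n * real n powr real p) \<le> B" by (auto elim: BseqE)
  define c where "c = (2 * real ?N * ?R + 2) ^ ?N"
  have c: "c \<ge> 0" by (simp add: c_def)
  show ?thesis
  proof (rule that)
    fix j :: nat assume j: "j \<ge> 1"
    define \<rho> where "\<rho> = 1 / real j ^ q"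
    have \<rho>: "\<rho> > 0" "real j ^ q \<ge> 1" using j by (auto simp: \<rho>_def one_le_power)
    have sq: "(4 * \<rho>) powr (1 / ?R) = 4 powr (1 / ?R) * (1 / real j ^ 2)"
    proof -
      have "(real j ^ q) powr (1 / ?R) = (real j powr real q) powr (1 / ?R)"
        using j by (subst powr_realpow) auto
      also have "\<dots> = real j powr (real q * (1 / ?R))" by (rule powr_powr)
      also have "real q * (1 / ?R) = 2" by (simp add: q_def field_simps)
      finally have "(real j ^ q) powr (1 / ?R) = real j ^ 2" using j by simp
      then show ?thesis unfolding \<rho>_def using j by (simp add: powr_divide del: of_nat_Suc)
    qed
    have \<theta>: "real j ^ (q * (?N + 1)) * \<theta> j \<le> B * (1 / real j ^ 2)"
    proof -
      have "\<theta> j * real j ^ p \<le> B" using B(2)[of j] j by (simp add: powr_realpow \<theta>_nonneg)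
      then show ?thesis using j by (simp add: p_def power_add power2_eq_square field_simps)
    qed
    have "(2 * real ?N * ?R / \<rho> + 2) ^ ?N * (L / \<rho> * \<theta> j) \<le> (c * (real j ^ q) ^ ?N) * (L * real j ^ q * \<theta> j)"
    proof (rule mult_mono)
      have "2 * real ?N * ?R / \<rho> + 2 \<le> (2 * real ?N * ?R + 2) * real j ^ q"
        using \<rho>(2) by (simp add: \<rho>_def distrib_right)
      then have "(2 * real ?N * ?R / \<rho> + 2) ^ ?N \<le> ((2 * real ?N * ?R + 2) * real j ^ q) ^ ?N"
        using \<rho>(1) by (intro power_mono) auto
      then show "(2 * real ?N * ?R / \<rho> + 2) ^ ?N \<le> c * (real j ^ q) ^ ?N"
        by (simp only: c_def power_mult_distrib)
    qed (use L_nonneg \<theta>_nonneg c in \<open>auto simp: \<rho>_def\<close>)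
    also have "\<dots> = c * L * (real j ^ (q * (?N + 1)) * \<theta> j)"
      by (simp add: power_mult[symmetric] power_add algebra_simps)
    also have "\<dots> \<le> c * L * (B * (1 / real j ^ 2))"
      using \<theta> c L_nonneg by (intro mult_left_mono) auto
    finally have 2: "(2 * real ?N * ?R / \<rho> + 2) ^ ?N * (L / \<rho> * \<theta> j) \<le> c * L * (B * (1 / real j ^ 2))" .
    have "prob {x \<in> space M. norm (f x) < ?R \<and> prob (obs_ball (f x) (3 * \<rho>)) \<le> (4 * \<rho>) powr (1 / ?R) \<and>
        dist (f ((T ^^ j) x)) (f x) < 2 * \<rho>}
      \<le> (4 * \<rho>) powr (1 / ?R) * (4 * real ?N + 2) ^ ?N + (2 * real ?N * ?R / \<rho> + 2) ^ ?N * (L / \<rho> * \<theta> j)"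
      using j \<rho>(1) by (intro prob_close_return_le) auto
    also have "\<dots> \<le> 4 powr (1 / ?R) * (1 / real j ^ 2) * (4 * real ?N + 2) ^ ?N + c * L * (B * (1 / real j ^ 2))"
      using 2 by (simp only: sq add_left_mono)
    also have "\<dots> = (4 powr (1 / ?R) * (4 * real ?N + 2) ^ ?N + c * L * B) * (1 / real j ^ 2)"
      by (simp add: distrib_right mult_ac add_divide_distrib)
    finally show "prob {x \<in> space M. norm (f x) < ?R \<and>
        prob (obs_ball (f x) (3 * (1 / real j ^ q))) \<le> (4 * (1 / real j ^ q)) powr (1 / ?R) \<and>
        dist (f ((T ^^ j) x)) (f x) < 2 * (1 / real j ^ q)}
      \<le> (4 powr (1 / ?R) * (4 * real ?N + 2) ^ ?N + c * L * B) * (1 / real j ^ 2)"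
      unfolding \<rho>_def .
  qed
qed

text \<open>As the threshold shrinks to 0, the sets decrease to the points with
  \<open>f ((T ^^ j) x) = f x\<close> for some \<open>j\<close> between 1 and \<open>J - 1\<close>,
  a null set by aperiodicity.\<close>

lemma early_return_scale:
  fixes J :: nat
  assumes "e > 0"
  obtains \<epsilon> where "\<epsilon> > 0" "{x \<in> space M. \<exists>j\<in>{1..<J}. dist (f ((T ^^ j) x)) (f x) < 2 * \<epsilon>} \<in> sets M"
    "prob {x \<in> space M. \<exists>j\<in>{1..<J}. dist (f ((T ^^ j) x)) (f x) < 2 * \<epsilon>} < e"
proof -
  define F where "F k = {x \<in> space M. \<exists>j\<in>{1..<J}. dist (f ((T ^^ j) x)) (f x) < 2 * (1 / real (Suc k))}" for k
  have sets: "F k \<in> sets M" for k unfolding F_def by measurable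
  have dec: "decseq F"
  proof (rule decseq_SucI)
    fix k
    have "2 * (1 / real (Suc (Suc k))) \<le> 2 * (1 / real (Suc k))" by (simp add: frac_le)
    then show "F (Suc k) \<subseteq> F k" unfolding F_def by (blast intro: less_le_trans)
  qed
  have "(\<lambda>k. prob (F k)) \<longlonglongrightarrow> prob (\<Inter>k. F k)"
    using sets dec by (intro finite_Lim_measure_decseq) auto
  moreover have "prob (\<Inter>k. F k) = 0"
  proof -
    have "AE x in M. x \<notin> (\<Inter>k. F k)"
      using aperiodic
    proof (rule AE_mp, intro AE_I2 impI notI)
      fix x assume x: "x \<in> space M" "\<forall>n\<ge>1. f ((T ^^ n) x) \<noteq> f x" "x \<in> (\<Inter>k. F k)"
      \<comment> \<open>Inserting 1 makes the minimum meaningful and positive also when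
        \<open>J \<le> 1\<close> and there are no times to consider.\<close>
      define \<delta> where "\<delta> = Min (insert 1 ((\<lambda>j. dist (f ((T ^^ j) x)) (f x)) ` {1..<J}))"
      have "\<delta> > 0" unfolding \<delta>_def using x(2) by (subst Min_gr_iff) auto
      then obtain k where k: "1 / real (Suc k) < \<delta> / 2" using nat_approx_posE[of "\<delta> / 2"] by auto
      from x(3) obtain j where j: "j \<in> {1..<J}" "dist (f ((T ^^ j) x)) (f x) < 2 * (1 / real (Suc k))"
        unfolding F_def by blast
      have "\<delta> \<le> dist (f ((T ^^ j) x)) (f x)" unfolding \<delta>_def using j(1) by (intro Min_le) auto
      then show False using j(2) k by linarith
    qed
    then have "(\<Inter>k. F k) \<in> null_sets M" using sets by (subst AE_iff_null_sets) auto
    then show ?thesis by (auto simp: null_sets_def measure_def)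
  qed
  ultimately have "eventually (\<lambda>k. prob (F k) < e) sequentially" using assms order_tendstoD(2) by metis
  then obtain k where "prob (F k) < e" by (auto simp: eventually_sequentially)
  then show ?thesis using that[of "1 / real (Suc k)"] sets[of k] unfolding F_def by simp
qed

text \<open>The bound on the mass of a ball is required only at the scale j^(-q) \<ge> r belonging to the return
  time j. It can therefore be transferred from the centre y to every x with f x in the ball
  of radius r around y, although the pointwise dimension at f x may vanish.\<close>

lemma exceptional_sets:
  fixes i :: nat
  defines "q \<equiv> 2 * Suc i"
  obtains P \<epsilon> where "\<And>J. P J \<in> sets M" "(\<lambda>J. prob (P J)) \<longlonglongrightarrow> 0" "\<And>J::nat. \<epsilon> J > (0::real)"
    "\<And>J y r r1. \<lbrakk>J \<ge> 1; norm y + 1 \<le> real (Suc i); \<forall>s. 0 < s \<and> s < r1 \<longrightarrow> prob (obs_ball y s) \<le> s powr (1 / real (Suc i));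
        4 * (1 / real J ^ q) < r1; 0 < r; r < 1; r < \<epsilon> J\<rbrakk> \<Longrightarrow>
      obs_ball y r - avoiding T (obs_ball y r) (nat \<lfloor>r powr (- 1 / real q)\<rfloor>) \<subseteq> P J"
proof -
  let ?R = "real (Suc i)"
  define G where "G j = (if j = 0 then {} else {x \<in> space M. norm (f x) < ?R \<and>
      prob (obs_ball (f x) (3 * (1 / real j ^ q))) \<le> (4 * (1 / real j ^ q)) powr (1 / ?R) \<and>
      dist (f ((T ^^ j) x)) (f x) < 2 * (1 / real j ^ q)})" for j
  have G_sets: "G j \<in> sets M" for j
  proof (cases "j = 0")
    case False
    then show ?thesis unfolding G_def if_not_P[OF False] by (intro sets_close_return) auto
  qed (simp add: G_def)
  obtain K where K: "\<And>j. j \<ge> 1 \<Longrightarrow> prob (G j) \<le> K * (1 / real j ^ 2)"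
  proof (rule prob_close_return_le_inverse_square[of i])
    fix K
    assume *: "\<And>j. j \<ge> 1 \<Longrightarrow> prob {x \<in> space M. norm (f x) < ?R \<and>
      prob (obs_ball (f x) (3 * (1 / real j ^ (2 * Suc i)))) \<le> (4 * (1 / real j ^ (2 * Suc i))) powr (1 / ?R) \<and>
      dist (f ((T ^^ j) x)) (f x) < 2 * (1 / real j ^ (2 * Suc i))} \<le> K * (1 / real j ^ 2)"
    show thesis
    proof (rule that)
      fix j :: nat assume "j \<ge> 1"
      then show "prob (G j) \<le> K * (1 / real j ^ 2)" using *[of j] unfolding G_def q_def by simp
    qed
  qed
  have "summable (\<lambda>j. K * (1 / real j ^ 2))"
    using inverse_power_summable[of 2, where 'a = real] by (intro summable_mult) (simp add: inverse_eq_divide)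
  then have sum: "summable (\<lambda>j. prob (G j))"
    by (rule summable_comparison_test'[where N = 1]) (use K in auto)
  \<comment> \<open>Late returns are collected in the tails of a Borel-Cantelli sequence; their
    masses tend to 0 because the intersection of the tails is \<open>limsup G\<close>.\<close>
  define H where "H J = (\<Union>j\<in>{J..}. G j)" for J
  have H_sets: "H J \<in> sets M" for J unfolding H_def using G_sets by auto
  have "limsup G \<in> null_sets M"
    using sum G_sets by (intro borel_cantelli_limsup1) (auto simp: emeasure_eq_measure)
  moreover have "limsup G = (\<Inter>J. H J)" unfolding H_def limsup_INF_SUP by (simp add: atLeast_def)
  ultimately have "prob (\<Inter>J. H J) = 0" by (simp add: null_sets_def measure_def)
  moreover have "decseq H" unfolding H_def decseq_def by (auto intro: order_trans)
  ultimately have H_lim: "(\<lambda>J. prob (H J)) \<longlonglongrightarrow> 0"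
    using finite_Lim_measure_decseq[of H] H_sets by auto
  have "\<forall>J. \<exists>\<epsilon>>0. {x \<in> space M. \<exists>j\<in>{1..<J}. dist (f ((T ^^ j) x)) (f x) < 2 * \<epsilon>} \<in> sets M \<and>
      prob {x \<in> space M. \<exists>j\<in>{1..<J}. dist (f ((T ^^ j) x)) (f x) < 2 * \<epsilon>} < 1 / real (Suc J)"
  proof
    fix J :: nat
    show "\<exists>\<epsilon>>0. {x \<in> space M. \<exists>j\<in>{1..<J}. dist (f ((T ^^ j) x)) (f x) < 2 * \<epsilon>} \<in> sets M \<and>
      prob {x \<in> space M. \<exists>j\<in>{1..<J}. dist (f ((T ^^ j) x)) (f x) < 2 * \<epsilon>} < 1 / real (Suc J)"
      by (rule early_return_scale[of "1 / real (Suc J)" J]) auto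
  qed
  from choice[OF this] obtain \<epsilon> where \<epsilon>: "\<And>J. \<epsilon> J > 0"
    "\<And>J. {x \<in> space M. \<exists>j\<in>{1..<J}. dist (f ((T ^^ j) x)) (f x) < 2 * \<epsilon> J} \<in> sets M"
    "\<And>J. prob {x \<in> space M. \<exists>j\<in>{1..<J}. dist (f ((T ^^ j) x)) (f x) < 2 * \<epsilon> J} < 1 / real (Suc J)"
    by blast
  define F where "F J = {x \<in> space M. \<exists>j\<in>{1..<J}. dist (f ((T ^^ j) x)) (f x) < 2 * \<epsilon> J}" for J
  have F: "F J \<in> sets M" "prob (F J) < 1 / real (Suc J)" for J using \<epsilon>(2,3)[of J] by (auto simp: F_def)
  show ?thesis
  proof (rule that[of "\<lambda>J. H J \<union> F J" \<epsilon>])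
    show "H J \<union> F J \<in> sets M" for J using H_sets F by auto
    show "\<epsilon> J > 0" for J by (rule \<epsilon>)
    show "(\<lambda>J. prob (H J \<union> F J)) \<longlonglongrightarrow> 0"
    proof (rule tendsto_sandwich[OF _ _ tendsto_const])
      show "eventually (\<lambda>J. prob (H J \<union> F J) \<le> prob (H J) + 1 / real (Suc J)) sequentially"
        using measure_Un_le[OF H_sets F(1)] F(2) by (intro always_eventually allI) (meson add_left_mono less_imp_le order_trans)
      have "(\<lambda>J. prob (H J) + 1 / real (Suc J)) \<longlonglongrightarrow> 0 + 0"
        by (intro tendsto_add H_lim LIMSEQ_Suc[OF lim_1_over_n])
      then show "(\<lambda>J. prob (H J) + 1 / real (Suc J)) \<longlonglongrightarrow> 0" by simp
    qed auto
    fix J :: nat and y :: "real^'n" and r r1 :: real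
    assume J: "J \<ge> 1" and y: "norm y + 1 \<le> ?R" "\<forall>s. 0 < s \<and> s < r1 \<longrightarrow> prob (obs_ball y s) \<le> s powr (1 / ?R)"
      and r1: "4 * (1 / real J ^ q) < r1" and r: "0 < r" "r < 1" "r < \<epsilon> J"
    show "obs_ball y r - avoiding T (obs_ball y r) (nat \<lfloor>r powr (- 1 / real q)\<rfloor>) \<subseteq> H J \<union> F J"
    proof
      fix x assume "x \<in> obs_ball y r - avoiding T (obs_ball y r) (nat \<lfloor>r powr (- 1 / real q)\<rfloor>)"
      then obtain j where x: "x \<in> space M" "dist y (f x) < r" and j: "j \<ge> 1" "j \<le> nat \<lfloor>r powr (- 1 / real q)\<rfloor>"
        and Tj: "dist y (f ((T ^^ j) x)) < r"
        by (auto simp: avoiding_def)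
      have close: "dist (f ((T ^^ j) x)) (f x) < 2 * r"
        using x(2) Tj dist_triangle2[of "f ((T ^^ j) x)" "f x" y] by (simp add: dist_commute)
      show "x \<in> H J \<union> F J"
      proof (cases "j < J")
        case True
        then have "x \<in> F J" unfolding F_def using x close j(1) r(3) by (auto intro!: bexI[of _ j])
        then show ?thesis by simp
      next
        case False
        define \<rho> where "\<rho> = 1 / real j ^ q"
        have "\<rho> > 0" using j(1) by (simp add: \<rho>_def)
        have "q > 0" by (simp add: q_def)
        \<comment> \<open>The time window inverts the scale: its upper bound for \<open>j\<close>
          amounts to \<open>r \<le> \<rho>\<close>.\<close>
        have "real j \<le> r powr (- 1 / real q)"
          using j(2) by (metis le_nat_floor le_floor_iff of_nat_floor of_nat_mono order_trans powr_ge_zero)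
        then have "real j ^ q \<le> (r powr (- 1 / real q)) ^ q" by (intro power_mono) auto
        also have "\<dots> = (r powr (- 1 / real q)) powr real q" using r(1) by (simp add: powr_realpow)
        also have "\<dots> = r powr (- 1 / real q * real q)" by (rule powr_powr)
        also have "- 1 / real q * real q = - 1" using \<open>q > 0\<close> by simp
        also have "r powr (- 1) = 1 / r" using r(1) by (simp add: powr_minus_divide)
        finally have "r \<le> \<rho>" using r(1) j(1) by (simp add: \<rho>_def field_simps)
        have "real J ^ q \<le> real j ^ q" using False by (intro power_mono) auto
        then have "\<rho> \<le> 1 / real J ^ q" unfolding \<rho>_def using J j(1) by (intro divide_left_mono) auto
        then have "4 * \<rho> < r1" using r1 by linarith
        \<comment> \<open>Since \<open>f x\<close> is within \<open>r \<le> \<rho>\<close> of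
          \<open>y\<close>, the radius grows from \<open>3 * \<rho>\<close> to
          \<open>4 * \<rho>\<close>; this is the origin of the 4 in \<open>G\<close>.\<close>
        have "obs_ball (f x) (3 * \<rho>) \<subseteq> obs_ball y (4 * \<rho>)"
        proof
          fix w assume "w \<in> obs_ball (f x) (3 * \<rho>)"
          then show "w \<in> obs_ball y (4 * \<rho>)"
            using x(2) \<open>r \<le> \<rho>\<close> dist_triangle[of y "f w" "f x"] by simp
        qed
        then have "prob (obs_ball (f x) (3 * \<rho>)) \<le> prob (obs_ball y (4 * \<rho>))"
          by (intro finite_measure_mono) auto
        also have "\<dots> \<le> (4 * \<rho>) powr (1 / ?R)" using y(2) \<open>\<rho> > 0\<close> \<open>4 * \<rho> < r1\<close> by simp
        finally have 1: "prob (obs_ball (f x) (3 * \<rho>)) \<le> (4 * \<rho>) powr (1 / ?R)" .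
        have 2: "norm (f x) < ?R"
          using x(2) y(1) r(2) dist_triangle[of 0 "f x" y] by simp
        have 3: "dist (f ((T ^^ j) x)) (f x) < 2 * \<rho>" using close \<open>r \<le> \<rho>\<close> by simp
        have "x \<in> G j" unfolding G_def \<rho>_def[symmetric] using 1 2 3 x(1) j(1) by simp
        then show ?thesis using False by (auto simp: H_def)
      qed
    qed
  qed
qed

end

lemma tendsto_powr_at_right_0:
  assumes "e > 0"
  shows "((\<lambda>r::real. r powr e) \<longlongrightarrow> 0) (at_right 0)"
proof (rule tendsto_zero_powrI[OF _ tendsto_const _ assms])
  show "eventually (\<lambda>r::real. 0 \<le> r) (at_right 0)"
    using eventually_at_right_less[of "0::real"] by (auto elim: eventually_mono)
qed (rule tendsto_ident_at)

lemma filterlim_powr_minus_at_right_0: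
  assumes "e > 0"
  shows "filterlim (\<lambda>r::real. r powr (- e)) at_top (at_right 0)"
proof -
  have "eventually (\<lambda>r::real. 0 < r powr e) (at_right 0)"
    using eventually_at_right_less[of "0::real"] by (auto elim: eventually_mono)
  with tendsto_powr_at_right_0[OF assms] have "filterlim (\<lambda>r::real. inverse (r powr e)) at_top (at_right 0)"
    by (rule filterlim_inverse_at_top)
  then show ?thesis by (simp add: powr_minus)
qed

section \<open>Early returns at almost every centre, and the balance of all error terms\<close>

context observed_system
begin

lemma AE_short_returns_negligible:
  "AE x in M. \<forall>i::nat. norm (f x) + 1 \<le> real (Suc i) \<longrightarrow>
     eventually (\<lambda>s. prob (obs_ball (f x) s) \<le> s powr (1 / real (Suc i))) (at_right 0) \<longrightarrow>
     ((\<lambda>r. prob (obs_ball (f x) r - avoiding T (obs_ball (f x) r) (nat \<lfloor>r powr (- 1 / real (2 * Suc i))\<rfloor>))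
        / prob (obs_ball (f x) r)) \<longlongrightarrow> 0) (at_right 0)"
  unfolding AE_all_countable
proof
  fix i :: nat
  define q where "q = 2 * Suc i"
  obtain P \<epsilon> where P [measurable]: "\<And>J. P J \<in> sets M" and lim: "(\<lambda>J. prob (P J)) \<longlonglongrightarrow> 0"
    and \<epsilon>: "\<And>J::nat. \<epsilon> J > (0::real)"
    and sub: "\<And>J y r r1. \<lbrakk>J \<ge> 1; norm y + 1 \<le> real (Suc i); \<forall>s. 0 < s \<and> s < r1 \<longrightarrow> prob (obs_ball y s) \<le> s powr (1 / real (Suc i));
        4 * (1 / real J ^ q) < r1; 0 < r; r < 1; r < \<epsilon> J\<rbrakk> \<Longrightarrow>
      obs_ball y r - avoiding T (obs_ball y r) (nat \<lfloor>r powr (- 1 / real q)\<rfloor>) \<subseteq> P J"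
    by (fact exceptional_sets[of i, folded q_def])
  \<comment> \<open>The maximal inequality supplies some index \<open>J\<close> without control of
    its size. Applying it to every shifted sequence gives indices beyond any \<open>J0\<close>,
    which may then depend on \<open>x\<close> through \<open>r1\<close>.\<close>
  have "AE x in M. \<forall>s>0. \<exists>J. \<forall>r>0. prob (P (J + J0) \<inter> f -` ball (f x) r) \<le> s * prob (obs_ball (f x) r)" for J0
    using LIMSEQ_ignore_initial_segment[OF lim, of J0]
    by (intro AE_relative_mass_vanishes[of f "\<lambda>J. P (J + J0)"]) auto
  then have "AE x in M. \<forall>J0. \<forall>s>0. \<exists>J. \<forall>r>0. prob (P (J + J0) \<inter> f -` ball (f x) r) \<le> s * prob (obs_ball (f x) r)"
    by (simp add: AE_all_countable)
  then show "AE x in M. norm (f x) + 1 \<le> real (Suc i) \<longrightarrow>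
     eventually (\<lambda>s. prob (obs_ball (f x) s) \<le> s powr (1 / real (Suc i))) (at_right 0) \<longrightarrow>
     ((\<lambda>r. prob (obs_ball (f x) r - avoiding T (obs_ball (f x) r) (nat \<lfloor>r powr (- 1 / real (2 * Suc i))\<rfloor>))
        / prob (obs_ball (f x) r)) \<longlongrightarrow> 0) (at_right 0)"
    unfolding q_def[symmetric]
  proof (rule AE_mp, intro AE_I2 impI)
    fix x
    assume x: "\<forall>J0. \<forall>s>0. \<exists>J. \<forall>r>0. prob (P (J + J0) \<inter> f -` ball (f x) r) \<le> s * prob (obs_ball (f x) r)"
      and norm: "norm (f x) + 1 \<le> real (Suc i)"
      and "eventually (\<lambda>s. prob (obs_ball (f x) s) \<le> s powr (1 / real (Suc i))) (at_right 0)"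
    then obtain r1 where r1: "r1 > 0" "\<forall>s. 0 < s \<and> s < r1 \<longrightarrow> prob (obs_ball (f x) s) \<le> s powr (1 / real (Suc i))"
      unfolding eventually_at_right[OF zero_less_one] by blast
    obtain J1 where J1: "4 / r1 < real J1" using reals_Archimedean2 by blast
    define J0 where "J0 = Suc J1"
    show "((\<lambda>r. prob (obs_ball (f x) r - avoiding T (obs_ball (f x) r) (nat \<lfloor>r powr (- 1 / real q)\<rfloor>))
        / prob (obs_ball (f x) r)) \<longlongrightarrow> 0) (at_right 0)"
    proof (rule tendstoI)
      fix e :: real assume e: "e > 0"
      obtain J where J: "\<forall>r>0. prob (P (J + J0) \<inter> f -` ball (f x) r) \<le> e / 2 * prob (obs_ball (f x) r)"
        using x e half_gt_zero by blast
      let ?J = "J + J0"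
      have scale: "4 * (1 / real ?J ^ q) < r1"
      proof -
        have "real ?J \<le> real ?J ^ q" by (rule self_le_power) (auto simp: J0_def q_def)
        then have "4 / r1 < real ?J ^ q" using J1 by (simp add: J0_def)
        moreover have "real ?J ^ q > 0" by (simp add: J0_def)
        ultimately show ?thesis using r1(1) by (simp add: field_simps)
      qed
      have main: "prob (obs_ball (f x) r - avoiding T (obs_ball (f x) r) (nat \<lfloor>r powr (- 1 / real q)\<rfloor>))
          / prob (obs_ball (f x) r) < e" if r: "0 < r" "r < min 1 (\<epsilon> ?J)" for r
      proof -
        let ?A = "obs_ball (f x) r"
        have "?A - avoiding T ?A (nat \<lfloor>r powr (- 1 / real q)\<rfloor>) \<subseteq> P ?J"
          using norm r1(2) scale r by (intro sub) (auto simp: J0_def)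
        then have "prob (?A - avoiding T ?A (nat \<lfloor>r powr (- 1 / real q)\<rfloor>)) \<le> prob (P ?J \<inter> f -` ball (f x) r)"
          by (intro finite_measure_mono sets_Int_vimage_ball) auto
        also have "\<dots> \<le> e / 2 * prob ?A" using J r(1) by blast
        \<comment> \<open>If the ball has mass 0, the quotient is 0 by convention.\<close>
        finally have "prob (?A - avoiding T ?A (nat \<lfloor>r powr (- 1 / real q)\<rfloor>)) / prob ?A \<le> e / 2"
          using e by (cases "prob ?A = 0") (auto simp: divide_le_eq zero_less_measure_iff)
        then show ?thesis using e by linarith
      qed
      have "eventually (\<lambda>r. 0 < r \<and> r < min 1 (\<epsilon> ?J)) (at_right (0::real))"
        unfolding eventually_at_right[OF zero_less_one] using \<epsilon>[of ?J] by (intro exI[of _ "min 1 (\<epsilon> ?J)"]) auto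
      then show "eventually (\<lambda>r. dist (prob (obs_ball (f x) r - avoiding T (obs_ball (f x) r) (nat \<lfloor>r powr (- 1 / real q)\<rfloor>))
          / prob (obs_ball (f x) r)) 0 < e) (at_right 0)"
        by eventually_elim (use main in \<open>simp add: dist_real_def\<close>)
    qed
  qed
qed

lemma hitting_statistics_limit:
  fixes y :: "real^'n"
  assumes d: "d > 0" and a: "a > 0" and b: "b \<ge> 0" and t: "t \<ge> 0"
    and lower: "eventually (\<lambda>r. r ^ (CARD('n) + 2) \<le> prob (obs_ball y r)) (at_right 0)"
    and upper: "eventually (\<lambda>r. prob (obs_ball y r) \<le> r powr d) (at_right 0)"
    and annulus: "eventually (\<lambda>r. \<forall>\<rho>. 0 < \<rho> \<and> \<rho> < r \<longrightarrow>
      prob (obs_ball y r - obs_ball y (r - \<rho>)) \<le> r powr (- b) * \<rho> powr a) (at_right 0)"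
    and short: "((\<lambda>r. prob (obs_ball y r - avoiding T (obs_ball y r) (nat \<lfloor>r powr (- (d / 2))\<rfloor>))
        / prob (obs_ball y r)) \<longlongrightarrow> 0) (at_right 0)"
  shows "((\<lambda>r. prob (space M \<inter> avoiding T (obs_ball y r) (nat \<lfloor>t / prob (obs_ball y r)\<rfloor>))) \<longlongrightarrow> exp (- t)) (at_right 0)"
    and "((\<lambda>r. prob (obs_ball y r \<inter> avoiding T (obs_ball y r) (nat \<lfloor>t / prob (obs_ball y r)\<rfloor>)) / prob (obs_ball y r))
      \<longlongrightarrow> exp (- t)) (at_right 0)"
proof -
  define \<kappa> where "\<kappa> = real (CARD('n) + 2)"
  define A where "A r = obs_ball y r" for r
  define m where "m r = prob (A r)" for r
  \<comment> \<open>Long enough for mixing, yet short compared with \<open>1 / m r\<close>, which is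
    eventually at least \<open>r powr (- d)\<close>.\<close>
  define n where "n r = nat \<lfloor>r powr (- (d / 2))\<rfloor>" for r :: real
  \<comment> \<open>The annulus of width \<open>r powr c\<close> then has mass at most
    \<open>r powr (\<kappa> + 1)\<close>, that is, \<open>r\<close> times the lower bound for
    \<open>m r\<close>. The summand 2 ensures \<open>c > 1\<close>, so the width stays below
    \<open>r\<close>.\<close>
  define c where "c = (b + \<kappa> + 1) / a + 2"
  \<comment> \<open>Decay of order \<open>p\<close> at time \<open>n r\<close> is of order
    \<open>r powr (c + \<kappa> + 1)\<close>: this compensates the Lipschitz factor
    \<open>r powr (- c)\<close> and the division by \<open>m r\<close>, with one factor
    \<open>r\<close> to spare.\<close>
  define p where "p = (c + \<kappa> + 1) * 2 / d"
  define \<sigma> where "\<sigma> r = prob (A r - avoiding T (A r) (n r))" for r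
  define \<eta> where "\<eta> r = 2 * prob (A r - A (r - r powr c)) + L / (r powr c) * \<theta> (n r)" for r
  define \<delta> where "\<delta> r = (\<sigma> r + \<eta> r) / m r + real (n r) * m r" for r
  have \<kappa>: "\<kappa> > 0" by (simp add: \<kappa>_def)
  have c: "c > 1" "a * c \<ge> b + \<kappa> + 1"
    using a b \<kappa> by (auto simp: c_def field_simps intro: add_nonneg_pos divide_nonneg_pos)
  have p: "p > 0" using c \<kappa> d by (simp add: p_def)
  have A_sets: "A r \<in> sets M" for r by (simp add: A_def)
  have small: "eventually (\<lambda>r. 0 < r \<and> r < 1) (at_right (0::real))"
    unfolding eventually_at_right[OF zero_less_one] by (auto intro!: exI[of _ 1])
  have m_lower: "eventually (\<lambda>r. r powr \<kappa> \<le> m r) (at_right 0)"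
    using small lower by eventually_elim (auto simp only: \<kappa>_def m_def A_def powr_realpow)
  have m_upper: "eventually (\<lambda>r. m r \<le> r powr d) (at_right 0)"
    using upper by (simp add: m_def A_def)
  have pos: "m r > 0" if "0 < r" "r powr \<kappa> \<le> m r" for r
  proof -
    have "0 < r powr \<kappa>" using that(1) by simp
    then show ?thesis using that(2) by linarith
  qed
  have m_pos: "eventually (\<lambda>r. m r > 0) (at_right 0)"
    using small m_lower by eventually_elim (use pos in auto)
  have "(m \<longlongrightarrow> 0) (at_right 0)"
    by (rule tendsto_sandwich[OF _ m_upper tendsto_const tendsto_powr_at_right_0[OF d]]) (simp add: m_def)
  then have m_lim: "filterlim m (at_right 0) (at_right 0)"
    unfolding filterlim_at using m_pos by (auto elim: eventually_mono)
  have u_top: "filterlim (\<lambda>r. r powr (- (d / 2))) at_top (at_right (0::real))"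
    using d by (intro filterlim_powr_minus_at_right_0) simp
  have u_large: "eventually (\<lambda>r. r powr (- (d / 2)) \<ge> 2) (at_right (0::real))"
    using u_top unfolding filterlim_at_top by blast
  \<comment> \<open>The floor of a number that is at least 2 is at least half of it.\<close>
  have n_bounds: "eventually (\<lambda>r. r powr (- (d / 2)) / 2 \<le> real (n r) \<and> real (n r) \<le> r powr (- (d / 2)) \<and> n r \<ge> 1) (at_right 0)"
    using u_large
  proof eventually_elim
    case (elim r)
    then have "real (n r) = of_int \<lfloor>r powr (- (d / 2))\<rfloor>" by (simp add: n_def)
    then have *: "r powr (- (d / 2)) - 1 \<le> real (n r)" "real (n r) \<le> r powr (- (d / 2))" by linarith+
    then have "real (n r) \<ge> 1" using elim by linarith
    then show ?case using * elim by auto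
  qed
  have "filterlim n at_top (at_right 0)"
    unfolding n_def using u_top by (intro filterlim_compose[OF filterlim_nat_sequentially] filterlim_compose[OF filterlim_floor_sequentially])
  then have \<theta>_small: "eventually (\<lambda>r. \<theta> (n r) * real (n r) powr p \<le> 1) (at_right 0)"
  proof -
    have "eventually (\<lambda>k. \<theta> k * real k powr p < 1) sequentially"
      using \<theta>_decay[OF p] by (rule order_tendstoD) simp
    then have "eventually (\<lambda>r. \<theta> (n r) * real (n r) powr p < 1) (at_right 0)"
      using \<open>filterlim n at_top (at_right 0)\<close> by (rule eventually_compose_filterlim)
    then show ?thesis by (auto elim: eventually_mono)
  qed
  have mix: "eventually (\<lambda>r. L / (r powr c) * \<theta> (n r) / m r \<le> L * 2 powr p * r) (at_right 0)"
    using small m_lower n_bounds \<theta>_small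
  proof eventually_elim
    case (elim r)
    then have r: "r > 0" by simp
    have np: "real (n r) powr p > 0" using elim by simp
    have "\<theta> (n r) \<le> 1 / real (n r) powr p" using elim np by (simp add: field_simps)
    also have "\<dots> \<le> 1 / (r powr (- (d / 2)) / 2) powr p"
      using elim r p by (intro divide_left_mono powr_mono2 mult_pos_pos) auto
    also have "\<dots> = 2 powr p * r powr (c + \<kappa> + 1)"
    proof -
      define e where "e = c + \<kappa> + 1"
      have "- (d / 2) * p = - e" using d by (simp add: p_def e_def field_simps)
      then have "(r powr (- (d / 2))) powr p = r powr (- e)" by (simp only: powr_powr)
      then have "(r powr (- (d / 2)) / 2) powr p = r powr (- e) / 2 powr p" by (simp only: powr_divide)
      moreover have "1 / (r powr (- e) / 2 powr p) = 2 powr p * r powr e"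
        using r by (simp add: powr_minus field_simps)
      ultimately show ?thesis unfolding e_def by (simp only:)
    qed
    finally have \<theta>: "\<theta> (n r) \<le> 2 powr p * r powr (c + \<kappa> + 1)" .
    have "L / (r powr c) * \<theta> (n r) / m r \<le> L / (r powr c) * (2 powr p * r powr (c + \<kappa> + 1)) / r powr \<kappa>"
      using \<theta> elim r L_nonneg \<theta>_nonneg by (intro frac_le mult_left_mono) auto
    also have "\<dots> = L * 2 powr p * r"
      using r by (simp add: powr_add)
    finally show ?case .
  qed
  have ann: "eventually (\<lambda>r. 2 * prob (A r - A (r - r powr c)) / m r \<le> 2 * r) (at_right 0)"
    using small m_lower annulus
  proof eventually_elim
    case (elim r)
    then have r: "0 < r" "r < 1" by auto
    have "r powr c < r powr 1" using r c(1) by (intro powr_less_mono') auto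
    then have "prob (A r - A (r - r powr c)) \<le> r powr (- b) * (r powr c) powr a"
      using elim(3) r unfolding A_def by simp
    also have "\<dots> = r powr (a * c - b)" by (simp add: powr_powr powr_add[symmetric] mult.commute)
    also have "\<dots> \<le> r powr (\<kappa> + 1)" using r c(2) by (intro powr_mono') auto
    also have "\<dots> = r * r powr \<kappa>" using r by (simp add: powr_add)
    also have "\<dots> \<le> r * m r" using r elim(2) by (intro mult_left_mono) auto
    finally have *: "prob (A r - A (r - r powr c)) \<le> r * m r" .
    have "m r > 0" using elim(2) r pos by auto
    then show ?case using * by (simp add: field_simps)
  qed
  have nm: "eventually (\<lambda>r. real (n r) * m r \<le> r powr (d / 2)) (at_right 0)"
    using small m_upper n_bounds
  proof eventually_elim
    case (elim r)
    then have "real (n r) * m r \<le> r powr (- (d / 2)) * r powr d"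
      by (intro mult_mono) (auto simp: m_def)
    also have "\<dots> = r powr (d / 2)" by (simp add: powr_add[symmetric])
    finally show ?case .
  qed
  have \<delta>_nonneg: "\<delta> r \<ge> 0" for r
    unfolding \<delta>_def \<sigma>_def \<eta>_def m_def using L_nonneg \<theta>_nonneg by auto
  have \<delta>_lim: "(\<delta> \<longlongrightarrow> 0) (at_right 0)"
  proof (rule tendsto_sandwich[OF _ _ tendsto_const])
    show "eventually (\<lambda>r. \<delta> r \<le> \<sigma> r / m r + 2 * r + L * 2 powr p * r + r powr (d / 2)) (at_right 0)"
      using mix ann nm by eventually_elim (simp add: \<delta>_def \<eta>_def add_divide_distrib)
    have "((\<lambda>r. \<sigma> r / m r + 2 * r + L * 2 powr p * r + r powr (d / 2)) \<longlongrightarrow> 0 + 2 * 0 + L * 2 powr p * 0 + 0) (at_right 0)"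
      using short tendsto_powr_at_right_0[of "d / 2"] d unfolding \<sigma>_def m_def A_def n_def by (intro tendsto_intros) auto
    then show "((\<lambda>r. \<sigma> r / m r + 2 * r + L * 2 powr p * r + r powr (d / 2)) \<longlongrightarrow> 0) (at_right 0)" by simp
  qed (simp add: \<delta>_nonneg)
  let ?k = "\<lambda>r. nat \<lfloor>t / m r\<rfloor>"
  let ?p = "\<lambda>r. prob (space M \<inter> avoiding T (A r) (?k r))"
  let ?q = "\<lambda>r. prob (A r \<inter> avoiding T (A r) (?k r)) / m r"
  have near: "eventually (\<lambda>r. \<bar>?p r - (1 - m r) ^ ?k r\<bar> \<le> \<delta> r \<and> \<bar>?q r - ?p r\<bar> \<le> \<delta> r) (at_right 0)"
    using small m_pos n_bounds
  proof eventually_elim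
    case (elim r)
    have \<eta>: "\<bar>prob (A r \<inter> (T ^^ n r) -` E) - prob (A r) * prob E\<bar> \<le> \<eta> r" if "E \<in> sets M" for E
      unfolding \<eta>_def A_def using elim that by (intro decay_obs_ball) auto
    have \<delta>: "\<bar>prob (A r \<inter> avoiding T (A r) k) / prob (A r) - prob (space M \<inter> avoiding T (A r) k)\<bar> \<le> \<delta> r" for k
      using conditional_avoiding_near_avoiding[OF A_sets _ \<eta>, of k] elim
      unfolding \<delta>_def \<sigma>_def m_def by blast
    have "\<bar>?p r - (1 - m r) ^ ?k r\<bar> \<le> \<delta> r * (1 - (1 - m r) ^ ?k r)"
      using elim \<delta> unfolding m_def by (intro prob_avoiding_near_geometric A_sets) auto
    also have "\<dots> \<le> \<delta> r"
      using \<delta>_nonneg by (intro mult_left_le) (auto simp: m_def)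
    finally show ?case using \<delta>[of "?k r"] unfolding m_def by simp
  qed
  have geo: "((\<lambda>r. (1 - m r) ^ ?k r) \<longlongrightarrow> exp (- t)) (at_right 0)"
    by (rule filterlim_compose[OF tendsto_one_minus_power_floor[OF t] m_lim])
  have "((\<lambda>r. ?p r - (1 - m r) ^ ?k r) \<longlongrightarrow> 0) (at_right 0)"
    by (rule Lim_null_comparison[OF _ \<delta>_lim]) (use near in \<open>auto elim: eventually_mono\<close>)
  from tendsto_add[OF this geo] have lim_p: "(?p \<longlongrightarrow> exp (- t)) (at_right 0)" by simp
  have "((\<lambda>r. ?q r - ?p r) \<longlongrightarrow> 0) (at_right 0)"
    by (rule Lim_null_comparison[OF _ \<delta>_lim]) (use near in \<open>auto elim: eventually_mono\<close>)
  from tendsto_add[OF this lim_p] have lim_q: "(?q \<longlongrightarrow> exp (- t)) (at_right 0)" by simp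
  show "((\<lambda>r. prob (space M \<inter> avoiding T (obs_ball y r) (nat \<lfloor>t / prob (obs_ball y r)\<rfloor>))) \<longlongrightarrow> exp (- t)) (at_right 0)"
    using lim_p unfolding m_def A_def .
  show "((\<lambda>r. prob (obs_ball y r \<inter> avoiding T (obs_ball y r) (nat \<lfloor>t / prob (obs_ball y r)\<rfloor>)) / prob (obs_ball y r))
      \<longlongrightarrow> exp (- t)) (at_right 0)"
    using lim_q unfolding m_def A_def .
qed

end

section \<open>Exponential limit laws\<close>

text \<open>On a one-point space \<open>lip_const\<close> would be the supremum of an empty set;
  \<open>u\<close> and \<open>v\<close> exclude this case.\<close>

lemma lip_const_bounds:
  fixes \<psi> :: "'a::metric_space \<Rightarrow> real"
  assumes "C-lipschitz_on UNIV \<psi>" "(u::'a) \<noteq> v"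
  shows "0 \<le> lip_const \<psi>" "lip_const \<psi> \<le> C"
proof -
  have le: "\<bar>\<psi> (fst p) - \<psi> (snd p)\<bar> / dist (fst p) (snd p) \<le> C" if "p \<in> {(x, y). x \<noteq> y}" for p
    using that lipschitz_onD[OF assms(1), of "fst p" "snd p"]
    by (auto simp: dist_real_def divide_le_eq)
  have ne: "(u, v) \<in> {(x, y). x \<noteq> y}" using assms(2) by simp
  show "lip_const \<psi> \<le> C"
    unfolding lip_const_def using ne le by (intro cSUP_least) blast+
  have "0 \<le> \<bar>\<psi> (fst (u, v)) - \<psi> (snd (u, v))\<bar> / dist (fst (u, v)) (snd (u, v))" by simp
  also have "\<dots> \<le> lip_const \<psi>"
    unfolding lip_const_def using ne le by (intro cSUP_upper bdd_aboveI2) blast+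
  finally show "0 \<le> lip_const \<psi>" .
qed

lemma sup_norm_indicator_bounds: "0 \<le> sup_norm (indicator E)" "sup_norm (indicator E) \<le> 1"
proof -
  have le: "\<bar>indicator E x :: real\<bar> \<le> 1" for x by (simp add: indicator_def)
  show "sup_norm (indicator E) \<le> 1" unfolding sup_norm_def using le by (intro cSUP_least) auto
  have "0 \<le> \<bar>indicator E undefined :: real\<bar>" by simp
  also have "\<dots> \<le> sup_norm (indicator E)"
    unfolding sup_norm_def using le by (intro cSUP_upper bdd_aboveI2[where M = 1]) auto
  finally show "0 \<le> sup_norm (indicator E)" .
qed

text \<open>Any positive \<open>d\<close> strictly below the lower dimension works. As
  \<open>ln r < 0\<close>, multiplying by it reverses the inequality, so a large quotient means a
  small mass.\<close>

lemma positive_lower_dim_imp_mass_le: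
  assumes "lower_pointwise_dim \<nu> y > 0"
  obtains d where "d > 0" "eventually (\<lambda>r. measure \<nu> (ball y r) \<le> r powr d) (at_right 0)"
proof -
  obtain d where d: "0 < ereal d" "ereal d < lower_pointwise_dim \<nu> y"
    using ereal_dense2[OF assms] by auto
  have "eventually (\<lambda>r. ereal d < (if measure \<nu> (ball y r) = 0 then \<infinity>
      else ereal (ln (measure \<nu> (ball y r)) / ln r))) (at_right 0)"
    using d(2) unfolding lower_pointwise_dim_def by (rule less_LiminfD)
  moreover have "eventually (\<lambda>r. 0 < r \<and> r < 1) (at_right (0::real))"
    unfolding eventually_at_right[OF zero_less_one] by (auto intro!: exI[of _ 1])
  ultimately have "eventually (\<lambda>r. measure \<nu> (ball y r) \<le> r powr d) (at_right 0)"
  proof eventually_elim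
    case (elim r)
    show ?case
    proof (cases "measure \<nu> (ball y r) = 0")
      case False
      then have pos: "measure \<nu> (ball y r) > 0" by (simp add: zero_less_measure_iff)
      have "d < ln (measure \<nu> (ball y r)) / ln r" using elim(1) False by simp
      then have "ln (measure \<nu> (ball y r)) < d * ln r"
        using elim(2) by (simp add: less_divide_eq)
      then have "exp (ln (measure \<nu> (ball y r))) \<le> exp (d * ln r)" by simp
      then show ?thesis using pos elim(2) by (simp add: powr_def)
    qed (use elim in simp)
  qed
  then show ?thesis using that d(1) by simp
qed

theorem theorem2p4:
  fixes M :: "'a::metric_space measure" and T :: "'a \<Rightarrow> 'a" and f :: "'a \<Rightarrow> real^'n"
  assumes "prob_space M"
    and "sets M = sets borel"
    and "T \<in> measurable M M"
    and "\<forall>A \<in> sets M. emeasure M (T -` A \<inter> space M) = emeasure M A"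
    and "superpoly_decay M T"
    and "\<exists>C. C-lipschitz_on UNIV f"
    and "emeasure M {x \<in> space M. \<exists>n::nat. n \<ge> 1 \<and> f ((T ^^ n) x) = f x} = 0"
    and "hypothesis_I (distr M borel f)"
  shows "\<forall>t::real. t \<ge> 0 \<longrightarrow>
    (AE x0 in M. lower_pointwise_dim (distr M borel f) (f x0) > 0 \<longrightarrow>
      ((\<lambda>r. measure M {x \<in> space M.
            hitting_time T f r x x0 > ereal (t / measure (distr M borel f) (ball (f x0) r))})
         \<longlongrightarrow> exp (-t)) (at_right 0)
    \<and> ((\<lambda>r. measure M ({x \<in> space M.
            hitting_time T f r x x0 > ereal (t / measure (distr M borel f) (ball (f x0) r))}
            \<inter> (f -` ball (f x0) r \<inter> space M)) / measure M (f -` ball (f x0) r \<inter> space M))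
         \<longlongrightarrow> exp (-t)) (at_right 0))"
proof (intro allI impI)
  fix t :: real assume t: "t \<ge> 0"
  interpret prob_space M by fact
  have space: "space M = UNIV" using sets_eq_imp_space_eq[OF assms(2)] by simp
  obtain L where L: "L-lipschitz_on UNIV f" using assms(6) by blast
  have f_meas [measurable]: "f \<in> borel_measurable M"
    using borel_measurable_continuous_onI[OF lipschitz_on_continuous_on[OF L]] assms(2)
    by (simp cong: measurable_cong_sets)
  interpret measure_preserving M T
    by unfold_locales (use assms(3,4) in \<open>auto simp: measure_def\<close>)
  define Per where "Per = {x \<in> space M. \<exists>n::nat. n \<ge> 1 \<and> f ((T ^^ n) x) = f x}"
  have "Per \<in> sets M" unfolding Per_def by measurable
  then have Per: "Per \<in> null_sets M" using assms(7) by (simp add: Per_def null_sets_def)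
  have aper: "AE x in M. \<forall>n\<ge>1. f ((T ^^ n) x) \<noteq> f x"
    by (rule AE_I'[OF Per]) (auto simp: Per_def)
  \<comment> \<open>A point outside \<open>Per\<close> is not fixed by \<open>T\<close>; together
    with its image it gives the two distinct points that \<open>lip_const_bounds\<close> asks
    for.\<close>
  have "Per \<noteq> space M" using Per emeasure_space_1 by (auto simp: null_sets_def)
  then obtain u where u: "f ((T ^^ 1) u) \<noteq> f u" unfolding Per_def space by blast
  then have uv: "(T ^^ 1) u \<noteq> u" by metis
  obtain \<theta> :: "nat \<Rightarrow> real" where \<theta>: "\<And>p. p > 0 \<Longrightarrow> (\<lambda>n. \<theta> n * real n powr p) \<longlonglongrightarrow> 0"
    and corr: "\<And>\<psi> \<phi> n. \<lbrakk>\<exists>C. C-lipschitz_on UNIV \<psi>; \<phi> \<in> borel_measurable M; bounded (range \<phi>); n \<ge> 1\<rbrakk> \<Longrightarrow>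
      \<bar>(\<integral>x. \<psi> x * \<phi> ((T ^^ n) x) \<partial>M) - (\<integral>x. \<psi> x \<partial>M) * (\<integral>x. \<phi> x \<partial>M)\<bar> \<le> lip_const \<psi> * sup_norm \<phi> * \<theta> n"
    using assms(5) unfolding superpoly_decay_def by blast
  \<comment> \<open>\<open>\<theta>\<close> may take negative values; its absolute value obeys the
    same decay and still bounds the correlations.\<close>
  interpret observed_system M T f L "\<lambda>n. \<bar>\<theta> n\<bar>"
  proof
    show "(\<lambda>n. \<bar>\<theta> n\<bar> * real n powr p) \<longlonglongrightarrow> 0" if "p > 0" for p
      using tendsto_rabs_zero[OF \<theta>[OF that]] by (simp add: abs_mult)
    fix C :: real and \<psi> :: "'a \<Rightarrow> real" and E and n :: nat
    assume *: "C-lipschitz_on UNIV \<psi>" "E \<in> sets M" "n \<ge> 1"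
    have "bounded (range (indicator E :: 'a \<Rightarrow> real))"
      by (rule boundedI[of _ 1]) (auto simp: indicator_def)
    then have "\<bar>(\<integral>x. \<psi> x * indicator E ((T ^^ n) x) \<partial>M) - (\<integral>x. \<psi> x \<partial>M) * (\<integral>x. indicator E x \<partial>M)\<bar>
        \<le> lip_const \<psi> * sup_norm (indicator E) * \<theta> n"
      using * by (intro corr) auto
    also have "\<dots> \<le> lip_const \<psi> * sup_norm (indicator E) * \<bar>\<theta> n\<bar>"
      using lip_const_bounds(1)[OF *(1) uv] sup_norm_indicator_bounds(1)[of E]
      by (intro mult_left_mono) auto
    also have "\<dots> \<le> C * 1 * \<bar>\<theta> n\<bar>"
      using lip_const_bounds[OF *(1) uv] sup_norm_indicator_bounds[of E]
      by (intro mult_right_mono mult_mono) auto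
    finally show "\<bar>(\<integral>x. \<psi> x * indicator E ((T ^^ n) x) \<partial>M) - (\<integral>x. \<psi> x \<partial>M) * prob E\<bar> \<le> C * \<bar>\<theta> n\<bar>"
      using *(2) by simp
  qed (use L aper in auto)
  have mass: "measure (distr M borel f) B = prob (space M \<inter> f -` B)" if "B \<in> sets borel" for B
    using that by (simp add: measure_distr Int_commute)
  have "AE x in M. \<exists>a>0. \<exists>b\<ge>0. eventually (\<lambda>r. \<forall>\<rho>. 0 < \<rho> \<and> \<rho> < r \<longrightarrow>
        measure (distr M borel f) (ball (f x) r - ball (f x) (r - \<rho>)) \<le> r powr (-b) * \<rho> powr a) (at_right 0)"
    using assms(8) unfolding hypothesis_I_def by (rule AE_distrD[OF f_meas])
  then show "AE x0 in M. lower_pointwise_dim (distr M borel f) (f x0) > 0 \<longrightarrow>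
      ((\<lambda>r. measure M {x \<in> space M.
            hitting_time T f r x x0 > ereal (t / measure (distr M borel f) (ball (f x0) r))})
         \<longlongrightarrow> exp (-t)) (at_right 0)
    \<and> ((\<lambda>r. measure M ({x \<in> space M.
            hitting_time T f r x x0 > ereal (t / measure (distr M borel f) (ball (f x0) r))}
            \<inter> (f -` ball (f x0) r \<inter> space M)) / measure M (f -` ball (f x0) r \<inter> space M))
         \<longlongrightarrow> exp (-t)) (at_right 0)"
    using AE_mass_of_ball_ge[OF f_meas] AE_short_returns_negligible
  proof eventually_elim
    case (elim x0)
    let ?y = "f x0"
    show ?case (is "_ \<longrightarrow> ?limits")
    proof
      assume "lower_pointwise_dim (distr M borel f) ?y > 0"
      then obtain d where d: "d > 0" "eventually (\<lambda>r. measure (distr M borel f) (ball ?y r) \<le> r powr d) (at_right 0)"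
        by (rule positive_lower_dim_imp_mass_le)
      obtain i :: nat where i: "1 / d + norm ?y + 1 \<le> real i" using real_arch_simple by blast
      have "1 / d > 0" using d(1) by simp
      then have "1 / d \<le> real (Suc i)" "norm ?y + 1 \<le> real (Suc i)"
        using i norm_ge_zero[of ?y] unfolding of_nat_Suc by linarith+
      then have di: "1 / real (Suc i) \<le> d" using d(1) by (simp add: field_simps)
      have small: "eventually (\<lambda>r. 0 < r \<and> r < 1) (at_right (0::real))"
        unfolding eventually_at_right[OF zero_less_one] by (auto intro!: exI[of _ 1])
      \<comment> \<open>Lowering the exponent from \<open>d\<close> to
        \<open>1 / real (Suc i)\<close> keeps the bound because \<open>r < 1\<close>, and it matches
        the time window of \<open>AE_short_returns_negligible\<close>.\<close>
      have upper: "eventually (\<lambda>r. prob (obs_ball ?y r) \<le> r powr (1 / real (Suc i))) (at_right 0)"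
        using d(2) small
      proof eventually_elim
        case (elim r)
        then have "prob (obs_ball ?y r) \<le> r powr d" by (simp add: mass)
        also have "\<dots> \<le> r powr (1 / real (Suc i))" using elim di by (intro powr_mono') auto
        finally show ?case .
      qed
      obtain a b where ab: "a > 0" "b \<ge> 0" and
        ann: "eventually (\<lambda>r. \<forall>\<rho>. 0 < \<rho> \<and> \<rho> < r \<longrightarrow>
          measure (distr M borel f) (ball ?y r - ball ?y (r - \<rho>)) \<le> r powr (-b) * \<rho> powr a) (at_right 0)"
        using elim(1) by blast
      have diff: "obs_ball ?y r - obs_ball ?y s = space M \<inter> f -` (ball ?y r - ball ?y s)" for r s by auto
      have ann': "eventually (\<lambda>r. \<forall>\<rho>. 0 < \<rho> \<and> \<rho> < r \<longrightarrow>
          prob (obs_ball ?y r - obs_ball ?y (r - \<rho>)) \<le> r powr (-b) * \<rho> powr a) (at_right 0)"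
        using ann unfolding diff by (simp add: mass)
      have exponent: "- 1 / real (2 * Suc i) = - ((1 / real (Suc i)) / 2)" by simp
      have short: "((\<lambda>r. prob (obs_ball ?y r - avoiding T (obs_ball ?y r) (nat \<lfloor>r powr (- ((1 / real (Suc i)) / 2))\<rfloor>))
          / prob (obs_ball ?y r)) \<longlongrightarrow> 0) (at_right 0)"
        using elim(3)[rule_format, OF \<open>norm ?y + 1 \<le> real (Suc i)\<close> upper] unfolding exponent .
      note limits = hitting_statistics_limit[OF _ ab t elim(2) upper ann' short]
      \<comment> \<open>This holds for every \<open>r\<close>: for a ball of mass 0 the threshold is
        \<open>t / 0 = 0\<close>, still nonnegative.\<close>
      have hit: "hitting_time T f r x x0 > ereal (t / measure (distr M borel f) (ball ?y r)) \<longleftrightarrow>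
          x \<in> avoiding T (obs_ball ?y r) (nat \<lfloor>t / prob (obs_ball ?y r)\<rfloor>)" for r x
        using t by (subst hitting_time_greater_iff) (auto simp: mass space)
      show ?limits
        unfolding hit using limits by (simp add: space Int_commute Collect_mem_eq)
    qed
  qed
qed

end
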